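(* Let $\alpha>-1$, $\gamma>-1$, $a>0$, $\beta>0$ and $u>0$. Then $$G^{2,0}_{1,2}\left[au\,\Big|\,{\alpha+\beta\atop \alpha,\ \gamma}\right]=\frac{a^{\gamma}}{\Gamma(\beta)}u^{\alpha}\int_{u}^{\infty}v^{\gamma-\alpha-\beta}(v-u)^{\beta-1}e^{-av}\,dv=\frac{a^{\gamma}}{\Gamma(\beta)}u^{\gamma}\int_0^1v^{\alpha-\gamma-1}(1-v)^{\beta-1}e^{-au/v}\,dv .$$ If moreover $\alpha-\gamma\ne\pm\nu$ for all $\nu=0,1,\dots$, then these also equal $$\frac{\Gamma(\gamma-\alpha)}{\Gamma(\beta)}(au)^{\alpha}\,{}_1F_1(1-\beta;1+\alpha-\gamma;-au)+\frac{\Gamma(\alpha-\gamma)}{\Gamma(\alpha+\beta-\gamma)}(au)^{\gamma}\,{}_1F_1(1+\gamma-\alpha-\beta;1+\gamma-\alpha;-au).$$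
   Context: Meijer G-function: for $z>0$, $$G^{m,n}_{p,q}\left[z\,\Big|\,{a_1,\dots,a_p\atop b_1,\dots,b_q}\right]=\frac1{2\pi i}\int_{\kappa-i\infty}^{\kappa+i\infty}\frac{\prod_{j=1}^m\Gamma(b_j+s)\prod_{j=1}^n\Gamma(1-a_j-s)}{\prod_{j=m+1}^q\Gamma(1-b_j-s)\prod_{j=n+1}^p\Gamma(a_j+s)}\,z^{-s}\,ds,$$ where the real number $\kappa$ is such that all poles of $\Gamma(b_j+s)$, $j\le m$, lie to the left and all poles of $\Gamma(1-a_j-s)$, $j\le n$, lie to the right of the line $\Re s=\kappa$. In the present case the integrand is $\frac{\Gamma(\alpha+s)\Gamma(\gamma+s)}{\Gamma(\alpha+\beta+s)}(au)^{-s}$ and $\kappa>\max(-\alpha,-\gamma)$. ${}_1F_1$ is the confluent hypergeometric series, and $1/\Gamma$ is taken to be $0$ at the poles of $\Gamma$. *)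

theory Defs
  imports "HOL-Complex_Analysis.Complex_Analysis"
begin

text \<open>
  The upper parameters \<open>A\<close> (of length \<open>p\<close>) and the lower parameters \<open>B\<close> (of length \<open>q\<close>) are lists,
  indexed from 0. The reciprocal Gamma factors are written with \<^const>\<open>rGamma\<close>, the entire
  function \<open>1/\<Gamma>\<close>.
\<close>

definition meijer_G_integrand ::
    "nat \<Rightarrow> nat \<Rightarrow> complex list \<Rightarrow> complex list \<Rightarrow> real \<Rightarrow> complex \<Rightarrow> complex" where
  "meijer_G_integrand m n A B z s =
     (\<Prod>j<m. Gamma (B ! j + s)) * (\<Prod>j<n. Gamma (1 - A ! j - s)) *
     (\<Prod>j\<in>{m..<length B}. rGamma (1 - B ! j - s)) * (\<Prod>j\<in>{n..<length A}. rGamma (A ! j + s)) *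
     complex_of_real z powr (-s)"

definition meijer_G_separates ::
    "nat \<Rightarrow> nat \<Rightarrow> complex list \<Rightarrow> complex list \<Rightarrow> real \<Rightarrow> bool" where
  "meijer_G_separates m n A B \<kappa> \<longleftrightarrow>
     (\<forall>j<m. \<forall>s. is_pole (\<lambda>s. Gamma (B ! j + s)) s \<longrightarrow> Re s < \<kappa>) \<and>
     (\<forall>j<n. \<forall>s. is_pole (\<lambda>s. Gamma (1 - A ! j - s)) s \<longrightarrow> \<kappa> < Re s)"

text \<open>
  \<open>w\<close> is the value of the integral over every admissible vertical line, parametrised as
  \<open>s = \<kappa> + \<i> t\<close>, and there is an admissible line. The gauge integral over the whole real line
  also covers conditionally convergent (improper) integrals.
\<close>

definition has_meijer_G ::
    "nat \<Rightarrow> nat \<Rightarrow> complex list \<Rightarrow> complex list \<Rightarrow> real \<Rightarrow> complex \<Rightarrow> bool" where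
  "has_meijer_G m n A B z w \<longleftrightarrow>
     (\<exists>\<kappa>. meijer_G_separates m n A B \<kappa>) \<and>
     (\<forall>\<kappa>. meijer_G_separates m n A B \<kappa> \<longrightarrow>
        ((\<lambda>t. 1 / (2 * pi * \<i>) * (meijer_G_integrand m n A B z (Complex \<kappa> t) * \<i>))
           has_integral w) UNIV)"

definition meijer_G ::
    "nat \<Rightarrow> nat \<Rightarrow> complex list \<Rightarrow> complex list \<Rightarrow> real \<Rightarrow> complex" where
  "meijer_G m n A B z = (THE w. has_meijer_G m n A B z w)"

lemma has_meijer_G_unique:
  assumes "has_meijer_G m n A B z w" "has_meijer_G m n A B z w'"
  shows "w = w'"
  using assms has_integral_unique unfolding has_meijer_G_def by blast

lemma meijer_G_eqI: "has_meijer_G m n A B z w \<Longrightarrow> meijer_G m n A B z = w"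
  unfolding meijer_G_def by (rule the_equality) (auto intro: has_meijer_G_unique)

definition hyp_1F1 :: "real \<Rightarrow> real \<Rightarrow> real \<Rightarrow> real" where
  "hyp_1F1 b c x = eval_fps (fps_hypergeo [b] [c] 1) x"

lemma hyp_1F1_altdef:
  "hyp_1F1 b c x = (\<Sum>k. pochhammer b k / (pochhammer c k * fact k) * x ^ k)"
  by (simp add: hyp_1F1_def eval_fps_def fps_hypergeo_nth)

end

theory Submission
  imports Defs "HOL-Probability.Probability"
begin

text \<open>
  Write \<open>c = \<alpha> - \<gamma>\<close>, \<open>w = au\<close> and \<open>F = \<integral> v\<^sup>c\<^sup>-\<^sup>1 (1 - v)\<^sup>\<beta>\<^sup>-\<^sup>1 exp (- w / v) dv\<close>
  over the unit interval. After the shift \<open>s \<mapsto> s + \<gamma>\<close> of the line of integration, the claim about the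
  G-function reads
  \<open>1 / (2\<pi>\<i>) \<integral> \<Gamma>(s) \<Gamma>(c + s) / \<Gamma>(c + \<beta> + s) w powr (-s) ds = F / \<Gamma>(\<beta>)\<close>. The reason is that
  \<open>\<Gamma>(c + s) \<Gamma>(\<beta>) / \<Gamma>(c + \<beta> + s)\<close> is the Beta integral \<open>\<integral> v powr (c + s - 1) (1 - v) powr (\<beta> - 1) dv\<close>.
  Exchanging the two integrals leaves the inner integral
  \<open>1 / (2\<pi>\<i>) \<integral> \<Gamma>(s) (w / v) powr (-s) ds = exp (- w / v)\<close>, the Cahen--Mellin formula. This is
  \<open>Mellin_Barnes_confluent\<close>. The exchange is absolute: the modulus of the double integrand is a product
  of a function of \<open>s\<close> and a function of \<open>v\<close>, and \<open>|\<Gamma>(s)| \<le> \<Gamma>(Re s + 2) / |s|\<^sup>2\<close> follows from applying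
  the functional equation twice, so no asymptotics of \<open>\<Gamma>\<close> are involved.

  Cahen--Mellin is Fourier inversion for \<open>exp (\<sigma> x - exp x)\<close>, whose transform is
  \<open>t \<mapsto> \<Gamma>(\<sigma> + \<i> t)\<close>; inversion itself is proved by Gaussian regularisation. The Beta integral for a
  complex exponent comes from the expansion of \<open>(1 - v) powr (\<beta> - 1)\<close> in powers of \<open>v\<close>: it gives a series
  of partial fractions in the exponent, holomorphic off the poles of \<open>\<Gamma>\<close> and known for positive
  reals, hence known everywhere (\<open>beta_partial_fractions\<close>). The representation over \<open>v > u\<close> is the
  substitution \<open>v \<mapsto> u / v\<close> in \<open>F\<close>.

  For the hypergeometric form, the same expansion of \<open>(1 - v) powr (\<beta> - 1)\<close> reduces \<open>F\<close> to the
  integrals \<open>\<integral> v powr (m - 1) exp (- w / v) dv\<close> with \<open>m = c + n\<close>. These are incomplete Gamma functions: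
  for noninteger \<open>m\<close> they equal \<open>w powr m \<Gamma>(-m)\<close> minus a power series in \<open>w\<close> with
  coefficients \<open>(-1)\<^sup>k / (k! (k - m))\<close>. The terms \<open>w powr m \<Gamma>(-m)\<close> sum to the first \<open>\<^sub>1F\<^sub>1\<close>. In the
  remaining double series the order of summation is exchanged, and the sum over \<open>n\<close> is again the
  partial fraction series, now evaluated at \<open>c - k\<close>, where it lies outside the range of the Beta integral as
  soon as \<open>k > c\<close>. This produces the second \<open>\<^sub>1F\<^sub>1\<close>.
\<close>

section \<open>Fourier inversion\<close>

lemma Fourier_std_normal_density:
  "(\<integral>t. iexp (t * x) * of_real (std_normal_density t) \<partial>lborel) = complex_of_real (exp (- x\<^sup>2 / 2))"
proof -
  have "complex_of_real (exp (- x\<^sup>2 / 2)) = char std_normal_distribution x"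
    by (simp add: char_std_normal_distribution)
  also have "\<dots> = (\<integral>t. std_normal_density t *\<^sub>R iexp (x * t) \<partial>lborel)"
    unfolding char_def by (subst integral_density) (auto simp: normal_density_nonneg)
  finally show ?thesis
    by (simp add: scaleR_conv_of_real mult_ac)
qed

lemma integrable_std_normal_density_scaled:
  "c \<noteq> 0 \<Longrightarrow> integrable lborel (\<lambda>t. std_normal_density (c * t))"
  using lborel_integrable_real_affine[of std_normal_density c 0]
  by (simp add: integrable_normal_density)

lemma Fourier_std_normal_density_scaled:
  assumes "N > 0"
  shows "(\<integral>t. iexp (t * x) * of_real (std_normal_density (t / N)) \<partial>lborel)
           = complex_of_real (N * exp (- (N * x)\<^sup>2 / 2))"
proof -
  have "(\<integral>t. iexp (t * x) * of_real (std_normal_density (t / N)) \<partial>lborel)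
      = N *\<^sub>R (\<integral>t. iexp (t * (N * x)) * of_real (std_normal_density t) \<partial>lborel)"
    using assms
    by (subst lborel_integral_real_affine[where c = N and t = 0]) (auto simp: mult_ac)
  then show ?thesis
    by (simp only: Fourier_std_normal_density) (simp add: scaleR_conv_of_real)
qed

text \<open>
  The Gaussians of width \<open>1 / (n + 1)\<close> around \<open>x\<^sub>0\<close>, all of mass \<open>sqrt (2 * pi)\<close>, form an approximate
  identity. Rescaling by the width makes this dominated convergence against one fixed Gaussian.
\<close>
lemma Gaussian_average_tendsto:
  fixes h :: "real \<Rightarrow> complex"
  assumes [measurable]: "h \<in> borel_measurable borel"
    and bdd: "\<And>x. norm (h x) \<le> B" and cont: "isCont h x\<^sub>0"
  shows "(\<lambda>n. \<integral>x. h x * of_real (real (Suc n) * exp (- (real (Suc n) * (x - x\<^sub>0))\<^sup>2 / 2)) \<partial>lborel)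
           \<longlonglongrightarrow> of_real (sqrt (2 * pi)) * h x\<^sub>0"
proof -
  have gauss: "exp (- z\<^sup>2 / 2) = sqrt (2 * pi) * std_normal_density z" for z :: real
    by (simp add: std_normal_density_def)
  have eq: "(\<integral>x. h x * of_real (real (Suc n) * exp (- (real (Suc n) * (x - x\<^sub>0))\<^sup>2 / 2)) \<partial>lborel)
          = (\<integral>z. h (x\<^sub>0 + z / real (Suc n)) * of_real (exp (- z\<^sup>2 / 2)) \<partial>lborel)" for n
    by (subst lborel_integral_real_affine[where c = "1 / real (Suc n)" and t = x\<^sub>0])
       (auto simp: field_simps scaleR_conv_of_real simp del: of_nat_Suc
             simp flip: integral_mult_right_zero)
  have "(\<lambda>n. \<integral>z. h (x\<^sub>0 + z / real (Suc n)) * of_real (exp (- z\<^sup>2 / 2)) \<partial>lborel)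
          \<longlonglongrightarrow> (\<integral>z. h x\<^sub>0 * of_real (exp (- z\<^sup>2 / 2)) \<partial>lborel)"
  proof (rule integral_dominated_convergence[where w = "\<lambda>z. B * (sqrt (2 * pi) * std_normal_density z)"])
    show "integrable lborel (\<lambda>z. B * (sqrt (2 * pi) * std_normal_density z))"
      by (intro integrable_mult_right) (simp add: integrable_normal_density)
    show "AE z in lborel. (\<lambda>n. h (x\<^sub>0 + z / real (Suc n)) * of_real (exp (- z\<^sup>2 / 2)))
            \<longlonglongrightarrow> h x\<^sub>0 * of_real (exp (- z\<^sup>2 / 2))"
    proof (intro AE_I2 tendsto_mult tendsto_const)
      fix z :: real
      have "(\<lambda>n. x\<^sub>0 + z / real (Suc n)) \<longlonglongrightarrow> x\<^sub>0 + 0"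
        by (intro tendsto_add tendsto_const LIMSEQ_Suc[of "\<lambda>n. z / real n"] lim_const_over_n)
      with cont show "(\<lambda>n. h (x\<^sub>0 + z / real (Suc n))) \<longlonglongrightarrow> h x\<^sub>0"
        by (intro isCont_tendsto_compose[of x\<^sub>0 h]) auto
    qed
    show "AE z in lborel. norm (h (x\<^sub>0 + z / real (Suc n)) * of_real (exp (- z\<^sup>2 / 2)))
            \<le> B * (sqrt (2 * pi) * std_normal_density z)" for n
      using bdd by (auto simp: norm_mult gauss[symmetric] intro!: mult_right_mono)
  qed auto
  also have "(\<integral>z. h x\<^sub>0 * of_real (exp (- z\<^sup>2 / 2)) \<partial>lborel)
           = h x\<^sub>0 * of_real (\<integral>z. exp (- z\<^sup>2 / 2) \<partial>lborel)"
    by (simp flip: integral_complex_of_real)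
  also have "(\<integral>z. exp (- z\<^sup>2 / 2) \<partial>lborel) = sqrt (2 * pi)"
    unfolding gauss by (simp add: integral_normal_density)
  finally show ?thesis
    unfolding eq by (simp only: mult.commute[of "h x\<^sub>0"])
qed

text \<open>
  Inserting \<open>h\<close> into the inverse transform directly gives a double integral that does not converge
  absolutely. The damping factor \<open>std_normal_density (t / (n + 1))\<close> makes it converge absolutely, and the order of
  integration can be exchanged. The inner integral is then a Gaussian average of \<open>h\<close>. Integrability
  of \<open>H\<close> allows the damping to be removed at the end.
\<close>
theorem Fourier_inversion:
  fixes h :: "real \<Rightarrow> complex"
  defines "H \<equiv> \<lambda>t. \<integral>x. h x * iexp (t * x) \<partial>lborel"
  assumes int_h: "integrable lborel h" and int_H: "integrable lborel H"
    and bdd: "\<And>x. norm (h x) \<le> B" and cont: "isCont h x\<^sub>0"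
  shows "(\<integral>t. H t * iexp (- t * x\<^sub>0) \<partial>lborel) = of_real (2 * pi) * h x\<^sub>0"
proof -
  have [measurable]: "h \<in> borel_measurable borel" "H \<in> borel_measurable borel"
    using int_h int_H by auto
  let ?I = "\<lambda>n. \<integral>t. H t * iexp (- t * x\<^sub>0) * of_real (std_normal_density (t / real (Suc n))) \<partial>lborel"
  have I_eq: "?I n = (\<integral>x. h x * of_real (real (Suc n) * exp (- (real (Suc n) * (x - x\<^sub>0))\<^sup>2 / 2)) \<partial>lborel)"
    for n
  proof -
    define N where "N = real (Suc n)"
    have N: "N > 0" by (simp add: N_def)
    let ?k = "\<lambda>t x. h x * (iexp (t * (x - x\<^sub>0)) * of_real (std_normal_density (t / N)))"
    have "(\<integral>t. H t * iexp (- t * x\<^sub>0) * of_real (std_normal_density (t / N)) \<partial>lborel)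
        = (\<integral>t. \<integral>x. ?k t x \<partial>lborel \<partial>lborel)"
      unfolding H_def
      by (intro Bochner_Integration.integral_cong refl)
         (simp add: exp_add [symmetric] algebra_simps flip: integral_mult_left_zero integral_mult_right_zero exp_add)
    also have "\<dots> = (\<integral>x. \<integral>t. ?k t x \<partial>lborel \<partial>lborel)"
    proof (rule lborel_pair.Fubini_integral[symmetric])
      have nk: "norm (?k t x) = norm (h x) * std_normal_density (t / N)" for t x
        by (simp add: norm_mult normal_density_nonneg)
      show "integrable (lborel \<Otimes>\<^sub>M lborel) (\<lambda>(t, x). ?k t x)"
      proof (rule lborel_pair.Fubini_integrable)
        have "integrable lborel (\<lambda>t. (\<integral>x. norm (h x) \<partial>lborel) * std_normal_density (t / N))"
          using integrable_std_normal_density_scaled[of "1 / N"] N by simp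
        then show "integrable lborel (\<lambda>t. \<integral>x. norm (case (t, x) of (t, x) \<Rightarrow> ?k t x) \<partial>lborel)"
          unfolding split nk by simp
        show "AE t in lborel. integrable lborel (\<lambda>x. case (t, x) of (t, x) \<Rightarrow> ?k t x)"
          unfolding split
        proof (intro AE_I2)
          fix t :: real
          have "integrable lborel (\<lambda>x. norm (h x) * std_normal_density (t / N))"
            using int_h by auto
          then show "integrable lborel (\<lambda>x. ?k t x)"
            by (rule Bochner_Integration.integrable_bound) (auto simp: norm_mult normal_density_nonneg)
        qed
      qed measurable
    qed
    also have "\<dots> = (\<integral>x. h x * of_real (N * exp (- (N * (x - x\<^sub>0))\<^sup>2 / 2)) \<partial>lborel)"
      by (simp only: integral_mult_right_zero Fourier_std_normal_density_scaled[OF N])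
    finally show ?thesis
      unfolding N_def .
  qed
  have "?I \<longlonglongrightarrow> (\<integral>t. H t * iexp (- t * x\<^sub>0) * of_real (std_normal_density 0) \<partial>lborel)"
  proof (rule integral_dominated_convergence[where w = "\<lambda>t. norm (H t) * std_normal_density 0"])
    show "integrable lborel (\<lambda>t. norm (H t) * std_normal_density 0)"
      using int_H by auto
    show "AE t in lborel. (\<lambda>n. H t * iexp (- t * x\<^sub>0) * of_real (std_normal_density (t / real (Suc n))))
            \<longlonglongrightarrow> H t * iexp (- t * x\<^sub>0) * of_real (std_normal_density 0)"
    proof (intro AE_I2 tendsto_mult tendsto_const tendsto_of_real)
      fix t :: real
      have "(\<lambda>n. t / real (Suc n)) \<longlonglongrightarrow> 0"
        by (intro LIMSEQ_Suc[of "\<lambda>n. t / real n"] lim_const_over_n)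
      then show "(\<lambda>n. std_normal_density (t / real (Suc n))) \<longlonglongrightarrow> std_normal_density 0"
        unfolding std_normal_density_def
        by (intro tendsto_intros) auto
    qed
    show "AE t in lborel. norm (H t * iexp (- t * x\<^sub>0) * of_real (std_normal_density (t / real (Suc n))))
            \<le> norm (H t) * std_normal_density 0" for n
    proof (intro AE_I2)
      fix t :: real
      have "std_normal_density (t / real (Suc n)) \<le> std_normal_density 0"
        by (simp add: std_normal_density_def divide_right_mono)
      then have "norm (H t) * std_normal_density (t / real (Suc n)) \<le> norm (H t) * std_normal_density 0"
        by (intro mult_left_mono) auto
      then show "norm (H t * iexp (- t * x\<^sub>0) * of_real (std_normal_density (t / real (Suc n))))
            \<le> norm (H t) * std_normal_density 0"
        by (simp only: norm_mult norm_exp_i_times norm_of_real abs_of_nonneg[OF normal_density_nonneg] mult_1_right)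
    qed
  qed auto
  moreover have "?I \<longlonglongrightarrow> of_real (sqrt (2 * pi)) * h x\<^sub>0"
    unfolding I_eq by (rule Gaussian_average_tendsto) (use bdd cont in auto)
  ultimately have "of_real (sqrt (2 * pi)) * h x\<^sub>0
      = (\<integral>t. H t * iexp (- t * x\<^sub>0) * of_real (std_normal_density 0) \<partial>lborel)"
    using LIMSEQ_unique by blast
  also have "\<dots> = (\<integral>t. H t * iexp (- t * x\<^sub>0) \<partial>lborel) / of_real (sqrt (2 * pi))"
    by (simp add: std_normal_density_def)
  finally have "(\<integral>t. H t * iexp (- t * x\<^sub>0) \<partial>lborel)
      = of_real (sqrt (2 * pi)) * of_real (sqrt (2 * pi)) * h x\<^sub>0"
    by (simp add: field_simps)
  also have "of_real (sqrt (2 * pi)) * of_real (sqrt (2 * pi)) = (of_real (2 * pi) :: complex)"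
    by (simp only: of_real_mult [symmetric]) simp
  finally show ?thesis .
qed

section \<open>The Gamma function on vertical lines\<close>

lemma norm_of_real_powr:
  "y > 0 \<Longrightarrow> norm (complex_of_real y powr z) = y powr Re z"
  by (simp add: powr_def)

lemma Re_pos_not_nonpos_Int: "Re z > 0 \<Longrightarrow> z \<notin> \<int>\<^sub>\<le>\<^sub>0"
  by (auto elim!: nonpos_Ints_cases)

lemma norm_Gamma_le_Gamma_Re:
  assumes "Re z > 0"
  shows "norm (Gamma z) \<le> Gamma (Re z)"
proof -
  let ?f = "\<lambda>t. complex_of_real t powr (z - 1) / of_real (exp t)"
  let ?g = "\<lambda>t. t powr (Re z - 1) / exp t"
  have f: "(?f has_integral Gamma z) {0..}" and g: "(?g has_integral Gamma (Re z)) {0..}"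
    using Gamma_integral_complex[OF assms] Gamma_integral_real[OF assms] by auto
  have "norm (integral {0..} ?f) \<le> integral {0..} ?g"
  proof (rule integral_norm_bound_integral)
    show "norm (?f t) \<le> ?g t" if "t \<in> {0..}" for t
      using that by (cases "t = 0") (auto simp: norm_divide norm_of_real_powr)
  qed (use f g in blast)+
  then show ?thesis
    using f g by (simp add: integral_unique)
qed

text \<open>
  \<open>\<Gamma>(z) = \<Gamma>(z + 2) / (z (z + 1))\<close>, and the numerator is bounded on vertical lines by the
  triangle inequality for Euler's integral.
\<close>
lemma norm_Gamma_quadratic_decay:
  assumes "Re z > 0"
  shows "norm (Gamma z) \<le> Gamma (Re z + 2) / (norm z)\<^sup>2"
proof -
  have z: "z \<noteq> 0" "z + 1 \<noteq> 0"
    using assms by (auto simp: complex_eq_iff)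
  have np: "z \<notin> \<int>\<^sub>\<le>\<^sub>0" "z + 1 \<notin> \<int>\<^sub>\<le>\<^sub>0"
    using assms by (auto intro!: Re_pos_not_nonpos_Int)
  have "Gamma (z + 2) = (z + 1) * (z * Gamma z)"
    using Gamma_plus1[of z] Gamma_plus1[of "z + 1"] z np by (simp add: add.assoc)
  then have "norm (z + 1) * (norm z * norm (Gamma z)) = norm (Gamma (z + 2))"
    by (simp only: norm_mult)
  also have "\<dots> \<le> Gamma (Re z + 2)"
    using norm_Gamma_le_Gamma_Re[of "z + 2"] assms by simp
  finally have le: "norm (z + 1) * (norm z * norm (Gamma z)) \<le> Gamma (Re z + 2)" .
  have "norm z \<le> norm (z + 1)"
    using assms by (auto simp: cmod_def intro!: power_mono)
  then have "norm z * (norm z * norm (Gamma z)) \<le> norm (z + 1) * (norm z * norm (Gamma z))"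
    by (intro mult_right_mono) auto
  also note le
  finally show ?thesis
    using z by (simp add: field_simps power2_eq_square)
qed

lemma continuous_on_Gamma_vertical:
  "\<sigma> > 0 \<Longrightarrow> continuous_on UNIV (\<lambda>t. Gamma (Complex \<sigma> t))"
  unfolding Complex_eq
  by (rule continuous_on_compose2[OF holomorphic_on_imp_continuous_on[OF holomorphic_Gamma[of "- \<int>\<^sub>\<le>\<^sub>0"]]])
     (use Re_pos_not_nonpos_Int[of "of_real \<sigma> + \<i> * of_real t" for t] in
       \<open>auto intro!: continuous_intros\<close>)

lemma integrable_Gamma_vertical:
  assumes "\<sigma> > 0"
  shows "integrable lborel (\<lambda>t. Gamma (Complex \<sigma> t))"
proof (rule Bochner_Integration.integrable_bound)
  \<comment> \<open>The second factor compares \<open>\<sigma>\<^sup>2 + t\<^sup>2\<close> with \<open>1 + t\<^sup>2\<close>.\<close>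
  define C where "C = Gamma (\<sigma> + 2) * (1 + 1 / \<sigma>\<^sup>2)"
  have C: "C \<ge> 0"
    using assms Gamma_real_pos[of "\<sigma> + 2"] by (simp add: C_def)
  have "integrable lborel (\<lambda>t. inverse (1 + t\<^sup>2) :: real)"
    using integrable_inverse_1_plus_square by (simp add: set_integrable_def)
  then show "integrable lborel (\<lambda>t. C * inverse (1 + t\<^sup>2))"
    by (rule integrable_mult_right)
  show "(\<lambda>t. Gamma (Complex \<sigma> t)) \<in> borel_measurable lborel"
    using continuous_on_Gamma_vertical[OF assms] by (simp add: borel_measurable_continuous_onI)
  show "AE t in lborel. norm (Gamma (Complex \<sigma> t)) \<le> norm (C * inverse (1 + t\<^sup>2))"
  proof (intro AE_I2)
    fix t :: real
    have pos: "\<sigma>\<^sup>2 + t\<^sup>2 > 0" "1 + t\<^sup>2 > 0"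
      using assms by (auto intro: add_pos_nonneg)
    have "(1 + t\<^sup>2) \<le> (1 + 1 / \<sigma>\<^sup>2) * (\<sigma>\<^sup>2 + t\<^sup>2)"
      using assms by (simp add: field_simps)
    then have "1 / (\<sigma>\<^sup>2 + t\<^sup>2) \<le> (1 + 1 / \<sigma>\<^sup>2) * inverse (1 + t\<^sup>2)"
      using pos by (simp add: field_simps)
    then have "Gamma (\<sigma> + 2) / (\<sigma>\<^sup>2 + t\<^sup>2) \<le> C * inverse (1 + t\<^sup>2)"
      using mult_left_mono[of "1 / (\<sigma>\<^sup>2 + t\<^sup>2)" _ "Gamma (\<sigma> + 2)"] assms Gamma_real_pos[of "\<sigma> + 2"]
      by (simp add: C_def mult.assoc)
    moreover have "norm (Gamma (Complex \<sigma> t)) \<le> Gamma (\<sigma> + 2) / (\<sigma>\<^sup>2 + t\<^sup>2)"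
      using norm_Gamma_quadratic_decay[of "Complex \<sigma> t"] assms by (simp add: cmod_power2)
    ultimately show "norm (Gamma (Complex \<sigma> t)) \<le> norm (C * inverse (1 + t\<^sup>2))"
      using C pos by simp
  qed
qed

text \<open>
  Euler's integral after the substitution \<open>r = exp x\<close>.
\<close>
lemma Gamma_Fourier:
  assumes "\<sigma> > 0"
  shows "integrable lborel (\<lambda>x. complex_of_real (exp (\<sigma> * x - exp x)) * iexp (t * x))"
    and "Gamma (Complex \<sigma> t) = (\<integral>x. complex_of_real (exp (\<sigma> * x - exp x)) * iexp (t * x) \<partial>lborel)"
proof -
  let ?f = "\<lambda>r. complex_of_real r powr (Complex \<sigma> t - 1) / of_real (exp r)"
  let ?h = "\<lambda>x. complex_of_real (exp (\<sigma> * x - exp x)) * iexp (t * x)"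
  have "range exp = {0 :: real<..}"
    by (auto simp: image_iff) (metis exp_ln)
  then have "?f absolutely_integrable_on range exp \<and> integral (range exp) ?f = Gamma (Complex \<sigma> t)"
    using absolutely_integrable_Gamma_integral'[of "Complex \<sigma> t"]
      Gamma_integral_complex'[of "Complex \<sigma> t"] assms
    by (simp add: integral_unique)
  then have "(\<lambda>x. \<bar>exp x\<bar> *\<^sub>R ?f (exp x)) absolutely_integrable_on UNIV \<and>
      integral UNIV (\<lambda>x. \<bar>exp x\<bar> *\<^sub>R ?f (exp x)) = Gamma (Complex \<sigma> t)"
    by (subst has_absolute_integral_change_of_variables_real)
       (auto intro!: derivative_eq_intros inj_onI)
  moreover have "\<bar>exp x\<bar> *\<^sub>R ?f (exp x) = ?h x" for x
    by (simp add: powr_def scaleR_conv_of_real Complex_eq exp_diff exp_add ring_distribs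
          exp_of_real [symmetric] mult_ac)
  ultimately have *: "?h absolutely_integrable_on UNIV" "integral UNIV ?h = Gamma (Complex \<sigma> t)"
    by simp_all
  have meas: "?h \<in> borel_measurable lborel"
    by simp
  show int: "integrable lborel ?h"
    using *(1) integrable_completion[OF meas] by (simp add: set_integrable_def)
  show "Gamma (Complex \<sigma> t) = (\<integral>x. ?h x \<partial>lborel)"
    using *(2) integral_lborel[OF int] by simp
qed

lemma of_real_powr_vertical:
  assumes "y > 0"
  shows "complex_of_real y powr (- Complex \<sigma> t) = of_real (y powr -\<sigma>) * iexp (- t * ln y)"
  using assms by (simp add: powr_def Complex_eq exp_add[symmetric] algebra_simps Ln_of_real flip: exp_of_real)

theorem Cahen_Mellin:
  assumes "\<sigma> > 0" "y > 0"
  shows "(\<integral>t. Gamma (Complex \<sigma> t) * of_real y powr (- Complex \<sigma> t) \<partial>lborel) = of_real (2 * pi * exp (-y))"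
proof -
  define h where "h = (\<lambda>x. complex_of_real (exp (\<sigma> * x - exp x)))"
  have H: "(\<integral>x. h x * iexp (t * x) \<partial>lborel) = Gamma (Complex \<sigma> t)" for t
    using Gamma_Fourier(2)[OF assms(1)] by (simp add: h_def)
  \<comment> \<open>The exponent is largest at x = ln \<sigma>; the bound is the tangent inequality for exp there.\<close>
  have bdd: "norm (h x) \<le> exp (\<sigma> * ln \<sigma> - \<sigma>)" for x
  proof -
    have "\<sigma> * (1 + (x - ln \<sigma>)) \<le> \<sigma> * exp (x - ln \<sigma>)"
      using assms exp_ge_add_one_self by (intro mult_left_mono) auto
    also have "\<dots> = exp x"
      using assms by (simp add: exp_diff)
    finally show ?thesis
      by (simp add: h_def algebra_simps)
  qed
  have "(\<integral>t. Gamma (Complex \<sigma> t) * iexp (- t * ln y) \<partial>lborel) = of_real (2 * pi) * h (ln y)"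
    using Fourier_inversion[of h "exp (\<sigma> * ln \<sigma> - \<sigma>)" "ln y"] Gamma_Fourier(1)[OF assms(1), of 0]
      integrable_Gamma_vertical[OF assms(1)] bdd
    unfolding H by (simp add: h_def)
  moreover have "(\<integral>t. Gamma (Complex \<sigma> t) * of_real y powr (- Complex \<sigma> t) \<partial>lborel)
      = of_real (y powr -\<sigma>) * (\<integral>t. Gamma (Complex \<sigma> t) * iexp (- t * ln y) \<partial>lborel)"
    unfolding of_real_powr_vertical[OF assms(2)]
    by (simp add: mult_ac flip: integral_mult_right_zero)
  moreover have "y powr -\<sigma> * exp (\<sigma> * ln y - exp (ln y)) = exp (-y)"
    using assms by (simp add: powr_def exp_add [symmetric])
  ultimately show ?thesis
    using assms by (simp add: h_def mult_ac flip: of_real_mult)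
qed

section \<open>The binomial series and the Beta integral with a complex exponent\<close>

text \<open>
  The coefficient of \<open>v\<^sup>n\<close> in the binomial series of \<open>(1 - v) powr (b - 1)\<close>.
\<close>
definition beta_coeff :: "real \<Rightarrow> nat \<Rightarrow> real" where
  "beta_coeff b n = pochhammer (1 - b) n / fact n"

lemma beta_coeff_sums:
  assumes "\<bar>v\<bar> < 1"
  shows "(\<lambda>n. beta_coeff b n * v ^ n) sums (1 - v) powr (b - 1)"
proof -
  have "beta_coeff b n * v ^ n = (b - 1 gchoose n) * (- v) ^ n" for n
  proof -
    have "(-1) ^ n * (- v) ^ n = v ^ n"
      by (simp flip: power_mult_distrib)
    then show ?thesis
      by (simp add: beta_coeff_def gbinomial_pochhammer mult_ac)
  qed
  then show ?thesis
    using gen_binomial_real[of "- v" "b - 1"] assms by simp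
qed

text \<open>
  Up to elementary factors the coefficients are the terms of the limit defining \<open>1 / \<Gamma>(1 - b)\<close>. They are
  therefore at most of order \<open>n powr (-b)\<close>, also when \<open>1 - b\<close> is a pole of \<open>\<Gamma>\<close>.
\<close>
lemma summable_beta_coeff:
  assumes "b > 0"
  shows "summable (\<lambda>n. \<bar>beta_coeff b n\<bar> / (real n + 1))"
proof -
  have "Bseq (rGamma_series (1 - b))"
    using rGamma_series_LIMSEQ[of "1 - b"] by (intro convergent_imp_Bseq convergentI)
  then obtain M where M: "M > 0" "\<And>n. \<bar>rGamma_series (1 - b) n\<bar> \<le> M"
    by (auto simp: Bseq_def)
  have "summable (\<lambda>n. \<bar>beta_coeff b (Suc n)\<bar> / (real (Suc n) + 1))"
  proof (rule summable_comparison_test'[where N = 1])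
    show "summable (\<lambda>n. M * real n powr (- b - 1))"
      using assms by (intro summable_mult) (simp add: summable_real_powr_iff)
    fix n :: nat assume n: "n \<ge> 1"
    have "beta_coeff b (Suc n) = rGamma_series (1 - b) n * real n powr (1 - b) / (real n + 1)"
      using n by (simp add: beta_coeff_def rGamma_series_def powr_def field_simps)
    then have "\<bar>beta_coeff b (Suc n)\<bar> = \<bar>rGamma_series (1 - b) n\<bar> * real n powr (1 - b) / (real n + 1)"
      by (simp add: abs_mult)
    also have "\<dots> \<le> M * real n powr (1 - b) / (real n + 1)"
      using M(2) by (intro divide_right_mono mult_right_mono) auto
    also have "\<dots> \<le> M * real n powr (1 - b) / real n"
      using n M(1) by (intro divide_left_mono) auto
    finally have "\<bar>beta_coeff b (Suc n)\<bar> / (real n + 2) \<le> M * real n powr (1 - b) / real n / real n"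
      using n M(1) by (intro frac_le) auto
    also have "\<dots> = M * real n powr (- b - 1)"
      using n by (simp add: powr_diff powr_minus powr_add field_simps power2_eq_square)
    finally show "norm (\<bar>beta_coeff b (Suc n)\<bar> / (real (Suc n) + 1)) \<le> M * real n powr (- b - 1)"
      by (simp add: add.commute)
  qed
  then show ?thesis
    by (subst (asm) summable_Suc_iff)
qed

lemma set_integral_powr_unit:
  assumes "p > 0"
  shows "set_integrable lborel {0<..<1} (\<lambda>v::real. v powr (p - 1))"
    and "(LINT v:{0<..<1}|lborel. v powr (p - 1)) = 1 / p"
proof -
  have "set_integrable lborel {0<..<1} (\<lambda>v. v powr (p - 1) * (1 - v) powr (1 - 1))"
    by (rule set_integrable_subset[OF integrable_Beta[of p 1]]) (use assms in auto)
  then show int: "set_integrable lborel {0<..<1} (\<lambda>v::real. v powr (p - 1))"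
    by (subst (asm) set_integrable_cong[OF refl]) auto
  have "((\<lambda>v. v powr (p - 1)) has_integral 1 / p) {0<..<1}"
    using has_integral_powr_from_0[of "p - 1" 1] assms by (simp add: has_integral_Icc_iff_Ioo)
  then show "(LINT v:{0<..<1}|lborel. v powr (p - 1)) = 1 / p"
    using set_borel_integral_eq_integral(2)[OF int] by (simp add: integral_unique)
qed

text \<open>
  The function \<open>h\<close> may be as singular at \<open>0\<close> as an integrable power. The integral of \<open>v\<^sup>n |h v|\<close> is then
  at most of order \<open>1 / (n + 1)\<close>, exactly what makes the series of absolute integrals converge.
\<close>
lemma
  fixes h :: "real \<Rightarrow> 'a :: {banach, second_countable_topology}"
  assumes "b > 0" "p > 0" and [measurable]: "h \<in> borel_measurable borel"
    and bound: "\<And>v. 0 < v \<Longrightarrow> v < 1 \<Longrightarrow> norm (h v) \<le> C * v powr (p - 1)"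
  shows set_integrable_beta_weight:
      "set_integrable lborel {0<..<1} (\<lambda>v. (1 - v) powr (b - 1) *\<^sub>R h v)"
    and beta_weight_termwise_integration:
      "(\<lambda>n. beta_coeff b n *\<^sub>R (LINT v:{0<..<1}|lborel. v ^ n *\<^sub>R h v))
         sums (LINT v:{0<..<1}|lborel. (1 - v) powr (b - 1) *\<^sub>R h v)"
proof -
  let ?f = "\<lambda>n v. indicator {0<..<1} v *\<^sub>R beta_coeff b n *\<^sub>R v ^ n *\<^sub>R h v"
  have C: "C \<ge> 0"
    using order_trans[OF norm_ge_zero bound[of "1/2"]] by (simp add: zero_le_mult_iff)
  have nf: "norm (?f n v) \<le> \<bar>beta_coeff b n\<bar> * C * (indicator {0<..<1} v *\<^sub>R v powr (n + p - 1))" for n v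
  proof (cases "v \<in> {0<..<1}")
    case True
    then have "v ^ n * norm (h v) \<le> v ^ n * (C * v powr (p - 1))"
      using bound by (intro mult_left_mono) auto
    also have "\<dots> = C * v powr (n + p - 1)"
      using True by (simp add: powr_realpow [symmetric] powr_add [symmetric] add_diff_eq)
    finally show ?thesis
      using True by (auto simp: abs_mult mult.assoc intro!: mult_left_mono)
  qed auto
  have pint: "integrable lborel (\<lambda>v. \<bar>beta_coeff b n\<bar> * C * (indicator {0<..<1} v *\<^sub>R v powr (n + p - 1)))" for n
    using set_integral_powr_unit(1)[of "n + p"] assms
    by (intro integrable_mult_right) (simp add: set_integrable_def)
  have int: "integrable lborel (?f n)" for n
  proof (rule Bochner_Integration.integrable_bound[OF pint[of n]])
    show "AE v in lborel. norm (?f n v) \<le>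
        norm (\<bar>beta_coeff b n\<bar> * C * (indicator {0<..<1} v *\<^sub>R v powr (n + p - 1)))"
      by (intro AE_I2 order_trans[OF nf]) (simp only: real_norm_def abs_ge_self)
  qed measurable
  \<comment> \<open>This constant bounds \<open>(n + 1) / (n + p)\<close> for large and for small \<open>p\<close> alike.\<close>
  define K where "K = 1 + 1 / p"
  have nint: "(\<integral>v. norm (?f n v) \<partial>lborel) \<le> C * K * (\<bar>beta_coeff b n\<bar> / (real n + 1))" for n
  proof -
    have "(\<integral>v. norm (?f n v) \<partial>lborel)
        \<le> (\<integral>v. \<bar>beta_coeff b n\<bar> * C * (indicator {0<..<1} v *\<^sub>R v powr (n + p - 1)) \<partial>lborel)"
      by (intro integral_mono integrable_norm int pint nf)
    also have "\<dots> = \<bar>beta_coeff b n\<bar> * C * (1 / (n + p))"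
      using set_integral_powr_unit(2)[of "n + p"] assms by (simp add: set_lebesgue_integral_def)
    also have "\<bar>beta_coeff b n\<bar> * C * (1 / (n + p)) \<le> \<bar>beta_coeff b n\<bar> * C * (K / (n + 1))"
    proof (intro mult_left_mono)
      have "K * (n + p) = n + 1 + (p + n / p)"
        using assms by (simp add: K_def field_simps)
      then have "n + 1 \<le> K * (n + p)"
        using assms by simp
      then show "1 / (n + p) \<le> K / (n + 1)"
        using assms by (simp add: pos_divide_le_eq pos_le_divide_eq)
    qed (use C in auto)
    finally show ?thesis by (simp add: mult_ac add.commute)
  qed
  have sum1: "AE v in lborel. summable (\<lambda>n. norm (?f n v))"
  proof (intro AE_I2)
    fix v :: real
    show "summable (\<lambda>n. norm (?f n v))"
    proof (cases "v \<in> {0<..<1}")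
      case True
      have "summable (\<lambda>n. norm (beta_coeff b n * v ^ n))"
        by (rule powser_insidea[of _ "(1 + v) / 2"])
           (use True beta_coeff_sums[of "(1 + v) / 2" b] in \<open>auto simp: sums_iff\<close>)
      then have "summable (\<lambda>n. norm (beta_coeff b n * v ^ n) * norm (h v))"
        by (rule summable_mult2)
      moreover have "norm (?f n v) = norm (beta_coeff b n * v ^ n) * norm (h v)" for n
        using True by (simp add: abs_mult)
      ultimately show ?thesis
        by (simp only:)
    qed auto
  qed
  have sum2: "summable (\<lambda>n. \<integral>v. norm (?f n v) \<partial>lborel)"
    by (rule summable_comparison_test'[OF summable_mult[OF summable_beta_coeff[OF \<open>b > 0\<close>], of "C * K"]])
       (use nint in \<open>auto simp del: norm_scaleR\<close>)
  have lim: "(\<Sum>n. ?f n v) = indicator {0<..<1} v *\<^sub>R (1 - v) powr (b - 1) *\<^sub>R h v" for v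
  proof (cases "v \<in> {0<..<1}")
    case True
    have "(\<lambda>n. (beta_coeff b n * v ^ n) *\<^sub>R h v) sums ((1 - v) powr (b - 1) *\<^sub>R h v)"
      using True by (intro sums_scaleR_left beta_coeff_sums) auto
    then show ?thesis
      using True by (simp add: sums_iff)
  qed auto
  show "set_integrable lborel {0<..<1} (\<lambda>v. (1 - v) powr (b - 1) *\<^sub>R h v)"
    using integrable_suminf[OF int sum1 sum2] by (simp only: lim set_integrable_def)
  have "(\<integral>v. ?f n v \<partial>lborel) = beta_coeff b n *\<^sub>R (LINT v:{0<..<1}|lborel. v ^ n *\<^sub>R h v)" for n
    unfolding set_lebesgue_integral_def by (subst scaleR_left_commute) (rule integral_scaleR_right)
  then show "(\<lambda>n. beta_coeff b n *\<^sub>R (LINT v:{0<..<1}|lborel. v ^ n *\<^sub>R h v))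
         sums (LINT v:{0<..<1}|lborel. (1 - v) powr (b - 1) *\<^sub>R h v)"
    using sums_integral[OF int sum1 sum2] by (simp only: lim) (simp only: set_lebesgue_integral_def)
qed

lemma beta_coeff_sums_Beta_real:
  assumes "b > 0" "x > 0"
  shows "(\<lambda>n. beta_coeff b n / (real n + x)) sums Beta x b"
proof -
  have eq: "(LINT v:{0<..<1}|lborel. v ^ n *\<^sub>R v powr (x - 1)) = 1 / (real n + x)" for n
  proof -
    have "(LINT v:{0<..<1}|lborel. v ^ n *\<^sub>R v powr (x - 1)) = (LINT v:{0<..<1}|lborel. v powr (n + x - 1))"
      by (intro set_lebesgue_integral_cong) (auto simp: powr_realpow [symmetric] powr_add [symmetric] add_diff_eq)
    then show ?thesis
      using set_integral_powr_unit(2)[of "n + x"] assms by simp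
  qed
  have int: "set_integrable lborel {0<..<1} (\<lambda>v. (1 - v) powr (b - 1) *\<^sub>R v powr (x - 1))"
    by (rule set_integrable_beta_weight[where C = 1 and p = x]) (use assms in auto)
  have "(LINT v:{0<..<1}|lborel. (1 - v) powr (b - 1) *\<^sub>R v powr (x - 1)) = Beta x b"
    using set_borel_integral_eq_integral(2)[OF int] has_integral_Beta_real[of x b] assms
    by (simp add: has_integral_Icc_iff_Ioo integral_unique mult.commute)
  moreover have "(\<lambda>n. beta_coeff b n *\<^sub>R (LINT v:{0<..<1}|lborel. v ^ n *\<^sub>R v powr (x - 1)))
       sums (LINT v:{0<..<1}|lborel. (1 - v) powr (b - 1) *\<^sub>R v powr (x - 1))"
    by (rule beta_weight_termwise_integration[where C = 1 and p = x]) (use assms in auto)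
  ultimately show ?thesis
    by (simp only: eq) simp
qed

text \<open>
  For large \<open>n\<close> the denominators grow linearly in \<open>n\<close>, uniformly on bounded sets. The finitely many terms that may have
  a pole in the disc do not affect uniform convergence: at a pole the term has the
  value \<open>0\<close>, and each term enters all later partial sums and the limit alike.
\<close>
lemma beta_coeff_uniform_limit:
  assumes "b > 0"
  shows "uniform_limit (cball z d) (\<lambda>N w. \<Sum>n<N. of_real (beta_coeff b n) / (w + of_nat n))
           (\<lambda>w. \<Sum>n. complex_of_real (beta_coeff b n) / (w + of_nat n)) sequentially"
proof (rule Weierstrass_m_test_ev)
  show "summable (\<lambda>n. 2 * (\<bar>beta_coeff b n\<bar> / (real n + 1)))"
    by (intro summable_mult summable_beta_coeff assms)
  define R where "R = norm z + d"
  show "\<forall>\<^sub>F n in sequentially. \<forall>w\<in>cball z d.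
          norm (of_real (beta_coeff b n) / (w + of_nat n)) \<le> 2 * (\<bar>beta_coeff b n\<bar> / (real n + 1))"
    \<comment> \<open>From this index on, \<open>n - R \<ge> (n + 1) / 2\<close>.\<close>
    using eventually_ge_at_top[of "nat \<lceil>2 * R + 1\<rceil>"]
  proof eventually_elim
    case (elim n)
    then have n: "real n \<ge> 2 * R + 1"
      by linarith
    show ?case
    proof
      fix w assume w: "w \<in> cball z d"
      then have "norm w \<le> R"
        using norm_triangle_ineq2[of w z] by (simp add: R_def dist_norm norm_minus_commute)
      moreover have "real n \<le> norm (w + of_nat n) + norm w"
        using norm_triangle_ineq4[of "w + of_nat n" w] by simp
      ultimately have le: "(real n + 1) / 2 \<le> norm (w + of_nat n)"
        using n by simp
      have "norm (complex_of_real (beta_coeff b n) / (w + of_nat n)) \<le> \<bar>beta_coeff b n\<bar> / ((real n + 1) / 2)"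
        unfolding norm_divide norm_of_real by (intro frac_le le) auto
      then show "norm (of_real (beta_coeff b n) / (w + of_nat n)) \<le> 2 * (\<bar>beta_coeff b n\<bar> / (real n + 1))"
        by (simp add: mult_ac)
    qed
  qed
qed

text \<open>
  Both sides are holomorphic off the nonpositive integers and agree on the positive reals, where the
  left side is the termwise integrated Beta integral. For fixed \<open>b\<close>, this is the partial fraction
  expansion of the Beta function continued beyond the half-plane where its integral
  converges.
\<close>
theorem beta_partial_fractions:
  fixes z :: complex
  assumes "b > 0" "z \<notin> \<int>\<^sub>\<le>\<^sub>0"
  shows "(\<lambda>n. of_real (beta_coeff b n) / (z + of_nat n)) sums (Gamma z * of_real (Gamma b) * rGamma (z + of_real b))"
proof -
  let ?S = "- \<int>\<^sub>\<le>\<^sub>0 :: complex set"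
  let ?F = "\<lambda>w. \<Sum>n. complex_of_real (beta_coeff b n) / (w + of_nat n)"
  let ?G = "\<lambda>w. Gamma w * of_real (Gamma b) * rGamma (w + of_real b)"
  have opn: "open ?S"
    by (auto intro: closed_nonpos_Ints)
  have nz: "w + of_nat n \<noteq> 0" if "w \<in> ?S" for w n
    using that by (auto simp: add_eq_0_iff2)
  have hol: "?F holomorphic_on ?S"
  proof (rule holomorphic_uniform_sequence[OF opn])
    show "(\<lambda>w. \<Sum>n<N. complex_of_real (beta_coeff b n) / (w + of_nat n)) holomorphic_on ?S" for N
      using nz by (intro holomorphic_intros) auto
    fix w assume "w \<in> ?S"
    then obtain d where "d > 0" "cball w d \<subseteq> ?S"
      using opn open_contains_cball by blast
    then show "\<exists>d>0. cball w d \<subseteq> ?S \<and> uniform_limit (cball w d)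
        (\<lambda>N w. \<Sum>n<N. complex_of_real (beta_coeff b n) / (w + of_nat n)) ?F sequentially"
      using beta_coeff_uniform_limit[OF assms(1)] by blast
  qed
  have "?F z - ?G z = 0"
  proof (rule analytic_continuation[of "\<lambda>w. ?F w - ?G w" ?S "of_real ` {0<..}" 1])
    show "(\<lambda>w. ?F w - ?G w) holomorphic_on ?S"
      by (intro holomorphic_intros hol) auto
    have "countable (\<int>\<^sub>\<le>\<^sub>0 :: complex set)"
      by (rule countable_subset[of _ "range of_int"]) (auto simp: nonpos_Ints_def)
    then have "connected (UNIV - \<int>\<^sub>\<le>\<^sub>0 :: complex set)"
      by (intro connected_open_diff_countable) auto
    then show "connected ?S"
      by (simp add: Compl_eq_Diff_UNIV)
    show "of_real ` {0<..} \<subseteq> ?S"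
      using Re_pos_not_nonpos_Int[of "of_real x" for x] by auto
    have "(1::real) islimpt {0<..}"
      by (intro interior_limit_point) (auto simp: interior_open)
    then show "1 islimpt complex_of_real ` {0<..}"
      using islimpt_isCont_image[of 1 "{0<..}" complex_of_real] by (simp add: eventually_at_filter)
    fix w assume "w \<in> complex_of_real ` {0<..}"
    then obtain x where x: "w = of_real x" "x > 0" by auto
    have "(\<lambda>n. complex_of_real (beta_coeff b n / (real n + x))) sums of_real (Beta x b)"
      using beta_coeff_sums_Beta_real[OF assms(1) x(2)] by (rule sums_of_real)
    then have "?F w = of_real (Beta x b)"
      by (simp add: x sums_iff add.commute)
    also have "\<dots> = ?G w"
      by (simp add: x Beta_def rGamma_inverse_Gamma divide_inverse Gamma_complex_of_real flip: of_real_add)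
    finally show "?F w - ?G w = 0" by simp
  qed (use opn assms in auto)
  moreover have "(\<lambda>N. \<Sum>n<N. complex_of_real (beta_coeff b n) / (z + of_nat n)) \<longlonglongrightarrow> ?F z"
    using tendsto_uniform_limitI[OF beta_coeff_uniform_limit[OF assms(1), of z 1]] by simp
  ultimately show ?thesis
    by (simp add: sums_def)
qed

text \<open>
  Termwise integration of the binomial series turns the integral into the partial fraction
  series.
\<close>
theorem Beta_integral_complex:
  assumes "b > 0" "Re z > 0"
  shows "set_integrable lborel {0<..<1} (\<lambda>v. (1 - v) powr (b - 1) *\<^sub>R (complex_of_real v powr (z - 1)))"
    and "(LINT v:{0<..<1}|lborel. (1 - v) powr (b - 1) *\<^sub>R (complex_of_real v powr (z - 1)))
           = Gamma z * of_real (Gamma b) * rGamma (z + of_real b)"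
proof -
  have meas: "(\<lambda>v. complex_of_real v powr (z - 1)) \<in> borel_measurable borel"
    by measurable
  have bound: "norm (complex_of_real v powr (z - 1)) \<le> 1 * v powr (Re z - 1)" if "0 < v" "v < 1" for v
    using that by (simp add: norm_of_real_powr)
  show "set_integrable lborel {0<..<1} (\<lambda>v. (1 - v) powr (b - 1) *\<^sub>R (complex_of_real v powr (z - 1)))"
    by (rule set_integrable_beta_weight[OF assms meas bound])
  have monomial: "(LINT v:{0<..<1}|lborel. v ^ n *\<^sub>R (complex_of_real v powr (z - 1))) = 1 / (z + of_nat n)" for n
  proof -
    let ?k = "\<lambda>v. v ^ n *\<^sub>R (complex_of_real v powr (z - 1))"
    have z: "z + of_nat n \<noteq> 0" "Re (z + of_nat n) > 0"
      using assms by (auto simp: complex_eq_iff)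
    have "norm (?k v) \<le> 1 * v powr (Re z - 1)" if "0 < v" "v < 1" for v
      using that mult_right_mono[OF power_le_one[of v n], of "v powr (Re z - 1)"]
      by (simp add: norm_of_real_powr)
    then have "set_integrable lborel {0<..<1} (\<lambda>v. (1 - v) powr (1 - 1) *\<^sub>R ?k v)"
      using assms by (intro set_integrable_beta_weight[where p = "Re z" and C = 1]) auto
    then have int: "set_integrable lborel {0<..<1} ?k"
      by (subst (asm) set_integrable_cong[OF refl]) auto
    have "((\<lambda>v. complex_of_real v powr (z + of_nat n - 1)) has_integral
            (of_real 1 powr (z + of_nat n) / (z + of_nat n) - of_real 0 powr (z + of_nat n) / (z + of_nat n))) {0..1}"
      using z assms by (intro fundamental_theorem_of_calculus_interior)
         (auto intro!: continuous_intros derivative_eq_intros has_vector_derivative_real_field)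
    then have "((\<lambda>v. complex_of_real v powr (z + of_nat n - 1)) has_integral 1 / (z + of_nat n)) {0<..<1}"
      by (simp add: has_integral_Icc_iff_Ioo)
    then have "(?k has_integral 1 / (z + of_nat n)) {0<..<1}"
      by (rule has_integral_eq[rotated]) (auto simp: scaleR_conv_of_real powr_add powr_diff powr_nat')
    then show ?thesis
      using set_borel_integral_eq_integral(2)[OF int] by (simp only: integral_unique)
  qed
  have "(\<lambda>n. beta_coeff b n *\<^sub>R (LINT v:{0<..<1}|lborel. v ^ n *\<^sub>R (complex_of_real v powr (z - 1))))
      sums (LINT v:{0<..<1}|lborel. (1 - v) powr (b - 1) *\<^sub>R (complex_of_real v powr (z - 1)))"
    by (rule beta_weight_termwise_integration[OF assms meas bound])
  then have "(\<lambda>n. of_real (beta_coeff b n) / (z + of_nat n))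
      sums (LINT v:{0<..<1}|lborel. (1 - v) powr (b - 1) *\<^sub>R (complex_of_real v powr (z - 1)))"
    by (simp only: monomial) (simp add: scaleR_conv_of_real)
  then show "(LINT v:{0<..<1}|lborel. (1 - v) powr (b - 1) *\<^sub>R (complex_of_real v powr (z - 1)))
           = Gamma z * of_real (Gamma b) * rGamma (z + of_real b)"
    using beta_partial_fractions[OF assms(1) Re_pos_not_nonpos_Int[OF assms(2)]] sums_unique2 by blast
qed

section \<open>The Mellin--Barnes integral of the confluent kernel\<close>

lemma power_div_fact_le_exp:
  fixes x :: real
  assumes "x \<ge> 0"
  shows "x ^ k / fact k \<le> exp x"
  using sum_le_suminf[OF summable_exp, of "{k}" x] assms
  by (simp add: exp_def divide_inverse scaleR_conv_of_real mult.commute)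

lemma exp_neg_reciprocal_bound:
  fixes v w q :: real
  assumes "v > 0" "w > 0"
  shows "v powr q * exp (- w / v) \<le> fact k / w ^ k * v powr (q + k)"
proof -
  have "(w / v) ^ k / fact k \<le> exp (w / v)"
    using assms by (intro power_div_fact_le_exp) auto
  then have "exp (- w / v) \<le> fact k / w ^ k * v ^ k"
    using assms by (simp add: exp_minus field_simps)
  then have "v powr q * exp (- w / v) \<le> v powr q * (fact k / w ^ k * v ^ k)"
    by (intro mult_left_mono) auto
  then show ?thesis
    using assms by (simp add: powr_add powr_realpow mult_ac)
qed

text \<open>
  The factor \<open>exp (- w / v)\<close> vanishes at \<open>0\<close> faster than any power, so every power of \<open>v\<close> may be treated
  as an integrable one.
\<close>
lemma exp_neg_reciprocal_dominated:
  fixes w q :: real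
  assumes "w > 0"
  obtains C p where "p > 0" "\<And>v. 0 < v \<Longrightarrow> v powr q * exp (- w / v) \<le> C * v powr (p - 1)"
proof
  define k where "k = nat \<lceil>- q\<rceil>"
  show "q + k + 1 > 0"
    unfolding k_def by linarith
  show "v powr q * exp (- w / v) \<le> fact k / w ^ k * v powr (q + k + 1 - 1)" if "0 < v" for v
    using exp_neg_reciprocal_bound[OF that assms] by simp
qed

lemma set_integrable_confluent_kernel:
  fixes b c w :: real
  assumes "b > 0" "w > 0"
  shows "set_integrable lborel {0<..<1} (\<lambda>v. v powr (c - 1) * (1 - v) powr (b - 1) * exp (- w / v))"
proof -
  obtain C p where "p > 0" and bd: "\<And>v. 0 < v \<Longrightarrow> v powr (c - 1) * exp (- w / v) \<le> C * v powr (p - 1)"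
    using exp_neg_reciprocal_dominated[OF assms(2)] by metis
  then have "set_integrable lborel {0<..<1} (\<lambda>v. (1 - v) powr (b - 1) *\<^sub>R (v powr (c - 1) * exp (- w / v)))"
    using assms by (intro set_integrable_beta_weight[where C = C and p = p]) auto
  then show ?thesis
    by (simp add: mult_ac)
qed

text \<open>
  This is \<open>\<Gamma>(b) exp (-w) U(b, 1 - c, w)\<close> for Tricomi's function \<open>U\<close>, as the substitution \<open>v = 1 / (1 + t)\<close>
  shows.
\<close>
definition confluent_integral :: "real \<Rightarrow> real \<Rightarrow> real \<Rightarrow> real" where
  "confluent_integral b c w =
     (LINT v:{0<..<1}|lborel. v powr (c - 1) * (1 - v) powr (b - 1) * exp (- w / v))"

text \<open>
  The double integrand \<open>A t * B v * v powr (\<i> t)\<close> has modulus \<open>|A t| * B v\<close>, so Fubini's theorem applies.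
  Integrating over \<open>v\<close> first gives the Beta integral and hence \<open>f\<close>; integrating over \<open>t\<close> first gives
  Cahen--Mellin at \<open>w / v\<close>.
\<close>
theorem Mellin_Barnes_confluent:
  fixes b c w \<sigma> :: real
  assumes "b > 0" "w > 0" "\<sigma> > 0" "c + \<sigma> > 0"
  defines "f \<equiv> \<lambda>s. Gamma s * Gamma (of_real c + s) * rGamma (of_real (c + b) + s) * of_real w powr (- s)"
  shows "integrable lborel (\<lambda>t. f (Complex \<sigma> t))"
    and "(\<integral>t. f (Complex \<sigma> t) \<partial>lborel) = of_real (2 * pi / Gamma b * confluent_integral b c w)"
proof -
  define A where "A = (\<lambda>t. Gamma (Complex \<sigma> t) * of_real w powr (- Complex \<sigma> t))"
  define B where "B = (\<lambda>v. indicator {0<..<1} v * (v powr (c + \<sigma> - 1) * (1 - v) powr (b - 1)) :: real)"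
  let ?P = "\<lambda>t v. A t * (of_real (B v) * iexp (t * ln v))"
  have Gb: "Gamma b \<noteq> 0"
    using Gamma_real_pos[OF assms(1)] by (metis less_irrefl)
  have [measurable]: "(\<lambda>t. Gamma (Complex \<sigma> t)) \<in> borel_measurable borel"
    using integrable_Gamma_vertical[OF \<open>\<sigma> > 0\<close>] by auto
  have A_measurable [measurable]: "A \<in> borel_measurable borel"
    unfolding A_def of_real_powr_vertical[OF assms(2)] by measurable
  have norm_A: "norm (A t) = w powr - \<sigma> * norm (Gamma (Complex \<sigma> t))" for t
    using assms unfolding A_def by (simp add: norm_mult norm_of_real_powr mult.commute)
  have int_A: "integrable lborel A"
  proof (rule Bochner_Integration.integrable_bound)
    show "integrable lborel (\<lambda>t. w powr - \<sigma> * norm (Gamma (Complex \<sigma> t)))"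
      using integrable_Gamma_vertical[OF \<open>\<sigma> > 0\<close>] by auto
  qed (auto simp: norm_A)
  have B_measurable [measurable]: "B \<in> borel_measurable borel"
    unfolding B_def by measurable
  have "set_integrable lborel {0<..<1} (\<lambda>v. v powr (c + \<sigma> - 1) * (1 - v) powr (b - 1))"
    by (rule set_integrable_subset[OF integrable_Beta]) (use assms in auto)
  then have int_B: "integrable lborel B"
    by (simp add: set_integrable_def B_def)
  have norm_P: "norm (?P t v) = norm (A t) * B v" for t v
    by (simp only: norm_mult norm_exp_i_times norm_of_real) (simp add: B_def)
  have int_P: "integrable (lborel \<Otimes>\<^sub>M lborel) (\<lambda>(t, v). ?P t v)"
  proof (rule lborel_pair.Fubini_integrable)
    show "integrable lborel (\<lambda>t. \<integral>v. norm (case (t, v) of (t, v) \<Rightarrow> ?P t v) \<partial>lborel)"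
      unfolding split norm_P using int_A by simp
    show "AE t in lborel. integrable lborel (\<lambda>v. case (t, v) of (t, v) \<Rightarrow> ?P t v)"
      unfolding split
    proof (intro AE_I2)
      fix t :: real
      have "integrable lborel (\<lambda>v. norm (A t) * B v)"
        using int_B by auto
      then show "integrable lborel (\<lambda>v. ?P t v)"
      proof (rule Bochner_Integration.integrable_bound)
        show "AE v in lborel. norm (?P t v) \<le> norm (norm (A t) * B v)"
          unfolding norm_P by (simp only: real_norm_def abs_ge_self AE_I2)
      qed measurable
    qed
  qed measurable
  have inner_v: "(\<integral>v. ?P t v \<partial>lborel) = of_real (Gamma b) * f (Complex \<sigma> t)" for t
  proof -
    have "(\<integral>v. of_real (B v) * iexp (t * ln v) \<partial>lborel)
        = (LINT v:{0<..<1}|lborel. (1 - v) powr (b - 1) *\<^sub>R (complex_of_real v powr (of_real c + Complex \<sigma> t - 1)))"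
      unfolding set_lebesgue_integral_def
    proof (intro Bochner_Integration.integral_cong refl)
      fix v :: real
      show "of_real (B v) * iexp (t * ln v) = indicator {0<..<1} v *\<^sub>R (1 - v) powr (b - 1) *\<^sub>R
              (complex_of_real v powr (of_real c + Complex \<sigma> t - 1))"
      proof (cases "v \<in> {0<..<1}")
        case True
        have "complex_of_real v powr (of_real c + Complex \<sigma> t - 1) = complex_of_real v powr (- Complex (1 - c - \<sigma>) (- t))"
          by (rule arg_cong[of _ _ "\<lambda>z. complex_of_real v powr z"]) (simp add: complex_eq_iff)
        also have "\<dots> = of_real (v powr (c + \<sigma> - 1)) * iexp (t * ln v)"
          using True by (subst of_real_powr_vertical) (auto simp: algebra_simps)
        finally show ?thesis
          using True by (simp add: B_def scaleR_conv_of_real)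
      qed (simp add: B_def)
    qed
    also have "\<dots> = Gamma (of_real c + Complex \<sigma> t) * of_real (Gamma b) * rGamma (of_real c + Complex \<sigma> t + of_real b)"
      using assms by (intro Beta_integral_complex) auto
    finally show ?thesis
      by (simp add: A_def f_def add_ac)
  qed
  have inner_t: "(\<integral>t. ?P t v \<partial>lborel)
      = of_real (2 * pi * (indicator {0<..<1} v *\<^sub>R (v powr (c - 1) * (1 - v) powr (b - 1) * exp (- w / v))))" for v
  proof (cases "v \<in> {0<..<1}")
    case True
    have "A t * iexp (t * ln v) = of_real (v powr - \<sigma>) * (Gamma (Complex \<sigma> t) * of_real (w / v) powr (- Complex \<sigma> t))" for t
    proof -
      have "iexp (- t * ln w) * iexp (t * ln v) = iexp (- t * ln (w / v))"
        using True assms by (simp add: ln_div exp_add [symmetric] algebra_simps)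
      moreover have "w powr - \<sigma> = v powr - \<sigma> * (w / v) powr - \<sigma>"
        using True assms by (simp add: powr_divide)
      ultimately show ?thesis
        using True assms unfolding A_def by (subst (1 2) of_real_powr_vertical) (auto simp: mult_ac)
    qed
    then have "?P t v = of_real (B v * v powr - \<sigma>) * (Gamma (Complex \<sigma> t) * of_real (w / v) powr (- Complex \<sigma> t))" for t
      by (simp add: mult_ac)
    then have "(\<integral>t. ?P t v \<partial>lborel) = of_real (B v * v powr - \<sigma>) * of_real (2 * pi * exp (- (w / v)))"
      using True assms by (simp only: integral_mult_right_zero) (subst Cahen_Mellin, auto)
    moreover have "v powr (c + \<sigma> - 1) * v powr - \<sigma> = v powr (c - 1)"
      by (simp flip: powr_add)
    ultimately show ?thesis
      using True by (simp add: B_def mult_ac flip: of_real_mult)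
  qed (simp add: B_def)
  have "integrable lborel (\<lambda>t. of_real (Gamma b) * f (Complex \<sigma> t))"
    using lborel_pair.integrable_fst[OF int_P] by (simp only: split inner_v)
  then have "integrable lborel (\<lambda>t. inverse (of_real (Gamma b)) * (of_real (Gamma b) * f (Complex \<sigma> t)))"
    by (rule integrable_mult_right)
  then show "integrable lborel (\<lambda>t. f (Complex \<sigma> t))"
    using Gb by (simp flip: mult.assoc)
  have "of_real (Gamma b) * (\<integral>t. f (Complex \<sigma> t) \<partial>lborel) = (\<integral>t. \<integral>v. ?P t v \<partial>lborel \<partial>lborel)"
    unfolding inner_v by (rule integral_mult_right_zero[symmetric])
  also have "\<dots> = (\<integral>v. \<integral>t. ?P t v \<partial>lborel \<partial>lborel)"
    by (rule lborel_pair.Fubini_integral[OF int_P, symmetric])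
  also have "\<dots> = of_real (2 * pi * confluent_integral b c w)"
    by (simp only: inner_t integral_complex_of_real integral_mult_right_zero confluent_integral_def set_lebesgue_integral_def)
  finally show "(\<integral>t. f (Complex \<sigma> t) \<partial>lborel) = of_real (2 * pi / Gamma b * confluent_integral b c w)"
    using Gb by (simp add: field_simps)
qed


section \<open>The G-function as a real integral\<close>

lemma is_pole_Gamma_add_iff:
  fixes a s :: complex
  shows "is_pole (\<lambda>s. Gamma (a + s)) s \<longleftrightarrow> a + s \<in> \<int>\<^sub>\<le>\<^sub>0"
proof
  assume "is_pole (\<lambda>s. Gamma (a + s)) s"
  moreover have "(\<lambda>s. Gamma (a + s)) analytic_on {s}" if "a + s \<notin> \<int>\<^sub>\<le>\<^sub>0"
    using that by (intro analytic_intros) auto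
  ultimately show "a + s \<in> \<int>\<^sub>\<le>\<^sub>0"
    using analytic_at_imp_no_pole by blast
next
  assume "a + s \<in> \<int>\<^sub>\<le>\<^sub>0"
  then obtain n where "a + s = - of_nat n"
    by (elim nonpos_Ints_cases')
  then have "is_pole Gamma (a + s)"
    using is_pole_Gamma by simp
  then show "is_pole (\<lambda>s. Gamma (a + s)) s"
    using is_pole_shift_iff[of Gamma a] by (simp add: o_def add.commute)
qed

lemma meijer_G_separates_iff:
  "meijer_G_separates 2 0 A [of_real \<alpha>, of_real \<gamma>] \<kappa> \<longleftrightarrow> - \<alpha> < \<kappa> \<and> - \<gamma> < \<kappa>"
proof -
  have "(\<forall>s. complex_of_real x + s \<in> \<int>\<^sub>\<le>\<^sub>0 \<longrightarrow> Re s < \<kappa>) \<longleftrightarrow> - x < \<kappa>" for x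
  proof
    assume "\<forall>s. complex_of_real x + s \<in> \<int>\<^sub>\<le>\<^sub>0 \<longrightarrow> Re s < \<kappa>"
    then show "- x < \<kappa>"
      by (auto dest: spec[of _ "- of_real x"])
  next
    assume "- x < \<kappa>"
    then show "\<forall>s. complex_of_real x + s \<in> \<int>\<^sub>\<le>\<^sub>0 \<longrightarrow> Re s < \<kappa>"
      using Re_pos_not_nonpos_Int[of "complex_of_real x + s" for s] by force
  qed
  then show ?thesis
    by (simp add: meijer_G_separates_def is_pole_Gamma_add_iff numeral_2_eq_2 All_less_Suc2)
qed

theorem has_meijer_G_confluent_integral:
  fixes \<alpha> \<beta> \<gamma> z :: real
  assumes "\<beta> > 0" "z > 0"
  shows "has_meijer_G 2 0 [of_real (\<alpha> + \<beta>)] [of_real \<alpha>, of_real \<gamma>] z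
           (of_real (z powr \<gamma> / Gamma \<beta> * confluent_integral \<beta> (\<alpha> - \<gamma>) z))"
  unfolding has_meijer_G_def meijer_G_separates_iff
proof (intro conjI allI impI)
  show "\<exists>\<kappa>. - \<alpha> < \<kappa> \<and> - \<gamma> < \<kappa>"
    by (rule exI[of _ "max (- \<alpha>) (- \<gamma>) + 1"]) auto
next
  fix \<kappa> assume \<kappa>: "- \<alpha> < \<kappa> \<and> - \<gamma> < \<kappa>"
  define c where "c = \<alpha> - \<gamma>"
  let ?f = "\<lambda>s. Gamma s * Gamma (of_real c + s) * rGamma (of_real (c + \<beta>) + s) * of_real z powr (- s)"
  have eq: "1 / (2 * pi * \<i>) * (meijer_G_integrand 2 0 [of_real (\<alpha> + \<beta>)] [of_real \<alpha>, of_real \<gamma>] z (Complex \<kappa> t) * \<i>)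
      = of_real (z powr \<gamma> / (2 * pi)) * ?f (Complex (\<gamma> + \<kappa>) t)" for t
  proof -
    define s where "s = Complex \<kappa> t"
    have shift: "Complex (\<gamma> + \<kappa>) t = of_real \<gamma> + s"
      by (simp add: s_def complex_eq_iff)
    have "complex_of_real z powr (- s) = of_real (z powr \<gamma>) * of_real z powr (- (of_real \<gamma> + s))"
      using assms by (simp add: powr_of_real [symmetric] powr_add [symmetric])
    then show ?thesis
      unfolding meijer_G_integrand_def s_def[symmetric] shift
      by (simp add: c_def numeral_2_eq_2 field_simps add_ac)
  qed
  have f: "integrable lborel (\<lambda>t. ?f (Complex (\<gamma> + \<kappa>) t))"
    "(\<integral>t. ?f (Complex (\<gamma> + \<kappa>) t) \<partial>lborel) = of_real (2 * pi / Gamma \<beta> * confluent_integral \<beta> c z)"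
    using assms \<kappa> by (intro Mellin_Barnes_confluent; simp add: c_def)+
  have "((\<lambda>t. of_real (z powr \<gamma> / (2 * pi)) * ?f (Complex (\<gamma> + \<kappa>) t)) has_integral
      of_real (z powr \<gamma> / (2 * pi)) * of_real (2 * pi / Gamma \<beta> * confluent_integral \<beta> c z)) UNIV"
    using has_integral_integral_lborel[OF f(1)] unfolding f(2) by (rule has_integral_mult_right)
  then show "((\<lambda>t. 1 / (2 * pi * \<i>) * (meijer_G_integrand 2 0 [of_real (\<alpha> + \<beta>)] [of_real \<alpha>, of_real \<gamma>] z
        (Complex \<kappa> t) * \<i>)) has_integral of_real (z powr \<gamma> / Gamma \<beta> * confluent_integral \<beta> (\<alpha> - \<gamma>) z)) UNIV"
    unfolding eq of_real_mult [symmetric] by (simp add: c_def)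
qed

text \<open>
  The substitution \<open>v = u / t\<close>.
\<close>
lemma confluent_integral_half_line:
  fixes \<alpha> \<beta> \<gamma> a u :: real
  assumes "\<beta> > 0" "a > 0" "u > 0"
  defines "f \<equiv> \<lambda>v. v powr (\<gamma> - \<alpha> - \<beta>) * (v - u) powr (\<beta> - 1) * exp (- a * v)"
  shows "f absolutely_integrable_on {u<..}"
    and "integral {u<..} f = u powr (\<gamma> - \<alpha>) * confluent_integral \<beta> (\<alpha> - \<gamma>) (a * u)"
proof -
  let ?g = "\<lambda>v. v powr (\<alpha> - \<gamma> - 1) * (1 - v) powr (\<beta> - 1) * exp (- (a * u) / v)"
  have g: "set_integrable lborel {0<..<1} ?g"
    by (rule set_integrable_confluent_kernel) (use assms in auto)
  have image: "(\<lambda>t. u / t) ` {0<..<1} = {u<..}"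
  proof safe
    fix x assume "u < x"
    then show "x \<in> (\<lambda>t. u / t) ` {0<..<1}"
      using assms by (intro image_eqI[of _ _ "u / x"]) auto
  qed (use assms in \<open>auto simp: field_simps\<close>)
  have eq: "\<bar>- u / t\<^sup>2\<bar> *\<^sub>R f (u / t) = u powr (\<gamma> - \<alpha>) * ?g t" if "t \<in> {0<..<1}" for t
  proof -
    have t: "0 < t" "t < 1" using that by auto
    have "u / t - u = u * (1 - t) / t"
      using t by (simp add: field_simps)
    then have "\<bar>- u / t\<^sup>2\<bar> *\<^sub>R f (u / t) =
        u / t\<^sup>2 * ((u / t) powr (\<gamma> - \<alpha> - \<beta>) * (u * (1 - t) / t) powr (\<beta> - 1) * exp (- a * (u / t)))"
      using t assms by (simp add: f_def)
    also have "(u / t) powr (\<gamma> - \<alpha> - \<beta>) = u powr (\<gamma> - \<alpha> - \<beta>) * t powr - (\<gamma> - \<alpha> - \<beta>)"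
      using t assms by (simp only: powr_minus_divide) (simp add: powr_divide)
    also have "(u * (1 - t) / t) powr (\<beta> - 1) = u powr (\<beta> - 1) * (1 - t) powr (\<beta> - 1) * t powr - (\<beta> - 1)"
      using t assms by (simp only: powr_minus_divide) (simp add: powr_divide powr_mult)
    also have "u / t\<^sup>2 = u powr 1 * t powr - 2"
      using t assms by (simp add: powr_minus_divide)
    also have "u powr 1 * t powr - 2 * (u powr (\<gamma> - \<alpha> - \<beta>) * t powr - (\<gamma> - \<alpha> - \<beta>) *
          (u powr (\<beta> - 1) * (1 - t) powr (\<beta> - 1) * t powr - (\<beta> - 1)) * exp (- a * (u / t)))
        = (u powr 1 * u powr (\<gamma> - \<alpha> - \<beta>) * u powr (\<beta> - 1)) *
          (t powr - 2 * t powr - (\<gamma> - \<alpha> - \<beta>) * t powr - (\<beta> - 1)) *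
          (1 - t) powr (\<beta> - 1) * exp (- (a * u) / t)"
      by simp
    also have "\<dots> = u powr (\<gamma> - \<alpha>) * ?g t"
      by (simp only: powr_add [symmetric]) (simp add: algebra_simps)
    finally show ?thesis .
  qed
  have ai: "(\<lambda>t. u powr (\<gamma> - \<alpha>) * ?g t) absolutely_integrable_on {0<..<1}"
    using g by (intro set_integrable_mult_right) (auto simp: set_integrable_def integrable_completion)
  then have ai': "(\<lambda>t. \<bar>- u / t\<^sup>2\<bar> *\<^sub>R f (u / t)) absolutely_integrable_on {0<..<1}"
    by (subst set_integrable_cong[OF refl refl eq]) auto
  have "integral {0<..<1} (\<lambda>t. \<bar>- u / t\<^sup>2\<bar> *\<^sub>R f (u / t)) = u powr (\<gamma> - \<alpha>) * confluent_integral \<beta> (\<alpha> - \<gamma>) (a * u)"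
    using set_borel_integral_eq_integral(2)[OF g]
    by (subst integral_cong[OF eq]) (auto simp: confluent_integral_def)
  with ai' have "(\<lambda>t. \<bar>- u / t\<^sup>2\<bar> *\<^sub>R f (u / t)) absolutely_integrable_on {0<..<1} \<and>
      integral {0<..<1} (\<lambda>t. \<bar>- u / t\<^sup>2\<bar> *\<^sub>R f (u / t)) = u powr (\<gamma> - \<alpha>) * confluent_integral \<beta> (\<alpha> - \<gamma>) (a * u)"
    by blast
  then have "f absolutely_integrable_on (\<lambda>t. u / t) ` {0<..<1} \<and>
      integral ((\<lambda>t. u / t) ` {0<..<1}) f = u powr (\<gamma> - \<alpha>) * confluent_integral \<beta> (\<alpha> - \<gamma>) (a * u)"
    by (rule has_absolute_integral_change_of_variables_real[THEN iffD1, rotated -1])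
       (use assms in \<open>auto intro!: derivative_eq_intros inj_onI simp: power2_eq_square field_simps\<close>)
  then show "f absolutely_integrable_on {u<..}"
    and "integral {u<..} f = u powr (\<gamma> - \<alpha>) * confluent_integral \<beta> (\<alpha> - \<gamma>) (a * u)"
    unfolding image by blast+
qed

section \<open>Power series for incomplete Gamma integrals\<close>

lemma set_integrable_exp_neg_reciprocal:
  fixes m w :: real
  assumes "w > 0"
  shows "set_integrable lborel {0<..<1} (\<lambda>v. v powr (m - 1) * exp (- w / v))"
proof -
  \<comment> \<open>The weight \<open>(1 - v) powr 0\<close> is \<open>1\<close> inside the open interval.\<close>
  have "set_integrable lborel {0<..<1} (\<lambda>v. v powr (m - 1) * (1 - v) powr (1 - 1) * exp (- w / v))"
    using assms by (intro set_integrable_confluent_kernel) auto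
  then show ?thesis
    by (subst (asm) set_integrable_cong[OF refl]) auto
qed

lemma exp_power_series_termwise_integration:
  fixes s w :: real
  assumes "s > 0"
  shows "set_integrable lborel {0<..<1} (\<lambda>r. r powr (s - 1) * exp (- w * r))"
    and "(\<lambda>k. (- w) ^ k / fact k / (s + real k)) sums
           (LINT r:{0<..<1}|lborel. r powr (s - 1) * exp (- w * r))"
proof -
  let ?f = "\<lambda>k r. indicator {0<..<1} r *\<^sub>R ((- w) ^ k / fact k * r powr (s + k - 1))"
  have int: "integrable lborel (?f k)" for k
    using set_integrable_mult_right[OF set_integral_powr_unit(1)[of "s + k"]] assms
    by (simp add: set_integrable_def)
  have norm_f: "norm (?f k r) = \<bar>w\<bar> ^ k / fact k * (indicator {0<..<1} r *\<^sub>R r powr (s + k - 1))" for k r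
    by (simp add: abs_mult power_abs)
  have val: "(\<integral>r. indicator {0<..<1} r *\<^sub>R r powr (s + k - 1) \<partial>lborel) = 1 / (s + k)" for k :: nat
    using set_integral_powr_unit(2)[of "s + k"] assms by (simp add: set_lebesgue_integral_def)
  have series: "(\<lambda>k. ?f k r) sums (indicator {0<..<1} r *\<^sub>R (r powr (s - 1) * exp (- w * r)))"
    and abs_series: "summable (\<lambda>k. norm (?f k r))" for r
  proof -
    have f_eq: "?f k r = (- w * r) ^ k /\<^sub>R fact k * (indicator {0<..<1} r * r powr (s - 1))" for k
    proof (cases "r \<in> {0<..<1}")
      case True
      then have "r powr (s + k - 1) = r ^ k * r powr (s - 1)"
        by (simp add: powr_realpow [symmetric] powr_add [symmetric] algebra_simps)
      then show ?thesis
        unfolding power_mult_distrib using True by (simp add: divide_inverse mult_ac)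
    qed simp
    show "(\<lambda>k. ?f k r) sums (indicator {0<..<1} r *\<^sub>R (r powr (s - 1) * exp (- w * r)))"
      using sums_mult2[OF exp_converges[of "- w * r"], of "indicator {0<..<1} r * r powr (s - 1)"]
      unfolding f_eq by (simp only: real_scaleR_def mult_ac)
    show "summable (\<lambda>k. norm (?f k r))"
      unfolding f_eq norm_mult by (intro summable_mult2 summable_norm_exp)
  qed
  have norm_sum: "summable (\<lambda>k. \<integral>r. norm (?f k r) \<partial>lborel)"
  proof (rule summable_comparison_test'[where N = 0])
    show "summable (\<lambda>k. \<bar>w\<bar> ^ k / fact k * (1 / s))"
      by (intro summable_mult2) (use summable_exp[of "\<bar>w\<bar>"] in \<open>simp add: divide_inverse mult.commute\<close>)
    show "norm (\<integral>r. norm (?f k r) \<partial>lborel) \<le> \<bar>w\<bar> ^ k / fact k * (1 / s)" for k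
      using assms unfolding norm_f integral_mult_right_zero val
      by (auto simp: abs_mult intro!: mult_left_mono divide_left_mono)
  qed
  show "set_integrable lborel {0<..<1} (\<lambda>r. r powr (s - 1) * exp (- w * r))"
    using integrable_suminf[OF int AE_I2[OF abs_series] norm_sum]
    unfolding set_integrable_def by (simp only: sums_unique[OF series, symmetric])
  have "(\<integral>r. ?f k r \<partial>lborel) = (- w) ^ k / fact k / (s + real k)" for k
    using val[of k] by (simp only: mult_scaleR_right[symmetric] integral_mult_right_zero) simp
  then show "(\<lambda>k. (- w) ^ k / fact k / (s + real k)) sums
           (LINT r:{0<..<1}|lborel. r powr (s - 1) * exp (- w * r))"
    using sums_integral[OF int AE_I2[OF abs_series] norm_sum]
    unfolding set_lebesgue_integral_def by (simp only: sums_unique[OF series, symmetric])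
qed

lemma Gamma_integral_real_scaled:
  fixes s w :: real
  assumes "s > 0" "w > 0"
  shows "((\<lambda>r. r powr (s - 1) * exp (- w * r)) has_integral (w powr - s * Gamma s)) {0<..}"
proof -
  let ?f = "\<lambda>t. t powr (s - 1) / exp t"
  have "(?f has_integral Gamma s) {0..}"
    by (rule Gamma_integral_real[OF assms(1)])
  then have f: "(?f has_integral Gamma s) {0<..}"
    by (subst (asm) has_integral_spike_set_eq[where T = "{0<..}"])
       (auto intro: negligible_subset[of "{0}"])
  then have f_abs: "?f absolutely_integrable_on {0<..}"
    by (intro nonnegative_absolutely_integrable_1) auto
  have image: "(\<lambda>r. w * r) ` {0<..} = {0<..}"
  proof safe
    fix x :: real assume "x > 0"
    then show "x \<in> (\<lambda>r. w * r) ` {0<..}"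
      using assms by (intro image_eqI[of _ _ "x / w"]) auto
  qed (use assms in auto)
  have "?f absolutely_integrable_on (\<lambda>r. w * r) ` {0<..} \<and>
      integral ((\<lambda>r. w * r) ` {0<..}) ?f = Gamma s"
    unfolding image using f_abs f by (simp add: integral_unique)
  then have "(\<lambda>r. \<bar>w\<bar> *\<^sub>R ?f (w * r)) absolutely_integrable_on {0<..} \<and>
      integral {0<..} (\<lambda>r. \<bar>w\<bar> *\<^sub>R ?f (w * r)) = Gamma s"
    by (rule has_absolute_integral_change_of_variables_real[THEN iffD2, rotated -1])
       (use assms in \<open>auto intro!: derivative_eq_intros inj_onI\<close>)
  then have "((\<lambda>r. \<bar>w\<bar> *\<^sub>R ?f (w * r)) has_integral Gamma s) {0<..}"
    using set_lebesgue_integral_eq_integral(1) has_integral_integrable_integral by blast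
  then have "((\<lambda>r. w powr - s * (\<bar>w\<bar> *\<^sub>R ?f (w * r))) has_integral (w powr - s * Gamma s)) {0<..}"
    by (rule has_integral_mult_right)
  moreover have "w powr - s * (\<bar>w\<bar> *\<^sub>R ?f (w * r)) = r powr (s - 1) * exp (- w * r)" if "r \<in> {0<..}" for r
  proof -
    have "w powr - s * (w powr 1 * w powr (s - 1)) = 1"
      using assms by (simp only: powr_add [symmetric]) simp
    then have "w powr - s * (w * w powr (s - 1)) = 1"
      using assms by simp
    moreover have "w powr - s * (\<bar>w\<bar> *\<^sub>R ?f (w * r))
        = w powr - s * (w * w powr (s - 1)) * (r powr (s - 1) * exp (- w * r))"
      using assms that by (simp add: powr_mult exp_minus divide_inverse)
    ultimately show ?thesis
      by simp
  qed
  ultimately show ?thesis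
    by (rule has_integral_eq[rotated])
qed

text \<open>
  With \<open>r = 1 / v\<close> the integral becomes that of \<open>r powr (- m - 1) exp (- w r)\<close> over \<open>r > 1\<close>. For negative \<open>m\<close>
  the integral over the whole half-line converges to \<open>w powr m \<Gamma>(-m)\<close>, and the piece over the unit
  interval, to be subtracted, is integrated termwise.
\<close>
lemma exp_neg_reciprocal_expansion_negative:
  fixes m w :: real
  assumes "m < 0" "w > 0"
  shows "(\<lambda>k. (- w) ^ k / fact k / (real k - m)) sums
           (w powr m * Gamma (- m) - (LINT v:{0<..<1}|lborel. v powr (m - 1) * exp (- w / v)))"
proof -
  let ?g = "\<lambda>v. v powr (m - 1) * exp (- w / v)"
  let ?f = "\<lambda>r. r powr (- m - 1) * exp (- w * r)"
  have image: "(\<lambda>r. 1 / r) ` {1<..} = {0<..<1::real}"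
  proof safe
    fix x :: real assume "x \<in> {0<..<1}"
    then show "x \<in> (\<lambda>r. 1 / r) ` {1<..}"
      by (intro image_eqI[of _ _ "1 / x"]) auto
  qed auto
  have g: "set_integrable lborel {0<..<1} ?g"
    using assms by (intro set_integrable_exp_neg_reciprocal)
  then have "?g absolutely_integrable_on (\<lambda>r. 1 / r) ` {1<..} \<and>
      integral ((\<lambda>r. 1 / r) ` {1<..}) ?g = (LINT v:{0<..<1}|lborel. ?g v)"
    unfolding image using set_borel_integral_eq_integral(2)[OF g]
    by (simp add: set_integrable_def integrable_completion)
  then have "(\<lambda>r. \<bar>- 1 / r\<^sup>2\<bar> *\<^sub>R ?g (1 / r)) absolutely_integrable_on {1<..} \<and>
      integral {1<..} (\<lambda>r. \<bar>- 1 / r\<^sup>2\<bar> *\<^sub>R ?g (1 / r)) = (LINT v:{0<..<1}|lborel. ?g v)"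
    by (rule has_absolute_integral_change_of_variables_real[THEN iffD2, rotated -1])
       (auto intro!: derivative_eq_intros inj_onI simp: power2_eq_square field_simps)
  then have "((\<lambda>r. \<bar>- 1 / r\<^sup>2\<bar> *\<^sub>R ?g (1 / r)) has_integral (LINT v:{0<..<1}|lborel. ?g v)) {1<..}"
    using set_lebesgue_integral_eq_integral(1) has_integral_integrable_integral by blast
  moreover have "\<bar>- 1 / r\<^sup>2\<bar> *\<^sub>R ?g (1 / r) = ?f r" if "r \<in> {1<..}" for r
  proof -
    have "\<bar>- 1 / r\<^sup>2\<bar> = r powr - 2"
      using that by (simp add: powr_minus_divide)
    moreover have "(1 / r) powr (m - 1) = r powr - (m - 1)"
      using that by (simp only: powr_minus_divide) (simp add: powr_divide)
    moreover have "- 2 + - (m - 1) = - m - 1"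
      by simp
    then have "r powr - 2 * r powr - (m - 1) = r powr (- m - 1)"
      by (simp only: powr_add [symmetric])
    ultimately show ?thesis
      using that by simp
  qed
  ultimately have upper: "(?f has_integral (LINT v:{0<..<1}|lborel. ?g v)) {1<..}"
    by (rule has_integral_eq[rotated])
  have whole: "(?f has_integral (w powr m * Gamma (- m))) {0<..}"
    using Gamma_integral_real_scaled[of "- m" w] assms by simp
  have lower_int: "set_integrable lborel {0<..<1} ?f"
    and lower_sums: "(\<lambda>k. (- w) ^ k / fact k / (- m + real k)) sums (LINT r:{0<..<1}|lborel. ?f r)"
    using exp_power_series_termwise_integration[of "- m" w] assms by auto
  have lower: "(?f has_integral (LINT r:{0<..<1}|lborel. ?f r)) {0<..<1}"
    using set_borel_integral_eq_integral[OF lower_int] by (simp add: has_integral_integrable_integral)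
  have "(?f has_integral ((LINT r:{0<..<1}|lborel. ?f r) + (LINT v:{0<..<1}|lborel. ?g v))) ({0<..<1} \<union> {1<..})"
  proof (rule has_integral_Un[OF lower upper])
    have "{0<..<1} \<inter> {1<..} = ({} :: real set)"
      by auto
    then show "negligible ({0<..<1} \<inter> {1<..} :: real set)"
      by simp
  qed
  then have "(?f has_integral ((LINT r:{0<..<1}|lborel. ?f r) + (LINT v:{0<..<1}|lborel. ?g v))) {0<..}"
    by (subst (asm) has_integral_spike_set_eq[where T = "{0<..}"])
       (rule negligible_subset[of "{1}"], simp, force)+
  then have "(LINT r:{0<..<1}|lborel. ?f r) + (LINT v:{0<..<1}|lborel. ?g v) = w powr m * Gamma (- m)"
    using whole has_integral_unique by blast
  then have "w powr m * Gamma (- m) - (LINT v:{0<..<1}|lborel. ?g v) = (LINT r:{0<..<1}|lborel. ?f r)"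
    by linarith
  then show ?thesis
    using lower_sums by simp
qed

text \<open>
  Integrate the derivative of \<open>v powr m * exp (- w / v)\<close> over the unit interval.
\<close>
lemma exp_neg_reciprocal_recurrence:
  fixes m w :: real
  assumes "w > 0"
  shows "m * (LINT v:{0<..<1}|lborel. v powr (m - 1) * exp (- w / v))
       + w * (LINT v:{0<..<1}|lborel. v powr (m - 1 - 1) * exp (- w / v)) = exp (- w)"
proof -
  let ?F = "\<lambda>v. v powr m * exp (- w / v)"
  let ?I = "\<lambda>m. LINT v:{0<..<1}|lborel. v powr (m - 1) * exp (- w / v)"
  have I: "((\<lambda>v. v powr (m - 1) * exp (- w / v)) has_integral ?I m) {0<..<1}" for m
    using set_borel_integral_eq_integral[OF set_integrable_exp_neg_reciprocal[OF assms, of m]]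
    by (simp add: has_integral_integrable_integral)
  have "((\<lambda>v. m * (v powr (m - 1) * exp (- w / v)) + w * (v powr (m - 1 - 1) * exp (- w / v)))
      has_integral (?F 1 - ?F 0)) {0..1}"
  proof (rule fundamental_theorem_of_calculus_interior)
    define k where "k = nat \<lceil>1 - m\<rceil>"
    have "m + k > 0"
      unfolding k_def by linarith
    \<comment> \<open>\<open>?F\<close> has the value \<open>0\<close> at \<open>0\<close> because \<open>0 powr m = 0\<close>, so this limit is continuity at the left end.\<close>
    have "(?F \<longlongrightarrow> 0) (at 0 within {0..1})"
    proof (rule Lim_null_comparison)
      show "\<forall>\<^sub>F v in at 0 within {0..1}. norm (?F v) \<le> fact k / w ^ k * v powr (m + k)"
        using exp_neg_reciprocal_bound[OF _ assms, of _ m k]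
        by (auto simp: eventually_at_filter intro!: always_eventually)
      have "((\<lambda>v::real. v powr (m + k)) \<longlongrightarrow> 0 powr (m + k)) (at 0 within {0..1})"
        using \<open>m + k > 0\<close> by (intro tendsto_powr2 tendsto_intros) (auto simp: eventually_at_filter)
      then show "((\<lambda>v. fact k / w ^ k * v powr (m + k)) \<longlongrightarrow> 0) (at 0 within {0..1})"
        by (intro tendsto_mult_right_zero) simp
    qed
    then have cont: "continuous (at v within {0..1}) ?F" if "v \<in> {0..1}" for v
      using that by (cases "v = 0") (auto simp: continuous_within intro!: tendsto_eq_intros)
    show "continuous_on {0..1} ?F"
      unfolding continuous_on_eq_continuous_within
    proof
      fix v :: real assume "v \<in> {0..1}"
      then show "continuous (at v within {0..1}) ?F"
        by (rule cont)
    qed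
    show "(?F has_vector_derivative
        m * (v powr (m - 1) * exp (- w / v)) + w * (v powr (m - 1 - 1) * exp (- w / v))) (at v)"
      if "v \<in> {0<..<1}" for v
    proof -
      have "v > 0" using that by simp
      have "((\<lambda>v. exp (- w / v)) has_real_derivative exp (- w / v) * (w / v\<^sup>2)) (at v)"
        using \<open>v > 0\<close> by (auto intro!: derivative_eq_intros simp: power2_eq_square)
      with has_real_derivative_powr[OF \<open>v > 0\<close>]
      have "(?F has_real_derivative m * v powr (m - 1) * exp (- w / v) + exp (- w / v) * (w / v\<^sup>2) * v powr m) (at v)"
        by (rule DERIV_mult)
      moreover have "v powr m = v powr (m - 1 - 1) * v\<^sup>2"
      proof -
        have "v\<^sup>2 = v powr 2"
          using \<open>v > 0\<close> by simp
        then show ?thesis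
          by (simp only: powr_add [symmetric]) simp
      qed
      then have "exp (- w / v) * (w / v\<^sup>2) * v powr m = w * (v powr (m - 1 - 1) * exp (- w / v))"
        using \<open>v > 0\<close> by simp
      ultimately show ?thesis
        unfolding has_real_derivative_iff_has_vector_derivative[symmetric] by (simp only: mult.assoc)
    qed
  qed simp
  then have "((\<lambda>v. m * (v powr (m - 1) * exp (- w / v)) + w * (v powr (m - 1 - 1) * exp (- w / v)))
      has_integral exp (- w)) {0<..<1}"
    by (simp only: has_integral_Icc_iff_Ioo) simp
  moreover have "((\<lambda>v. m * (v powr (m - 1) * exp (- w / v)) + w * (v powr (m - 1 - 1) * exp (- w / v)))
      has_integral (m * ?I m + w * ?I (m - 1))) {0<..<1}"
    by (intro has_integral_add has_integral_mult_right I)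
  ultimately show ?thesis
    using has_integral_unique by blast
qed

text \<open>
  The combination \<open>m X(m) + w X(m - 1)\<close> equals \<open>exp (-w)\<close> for the integral, \<open>0\<close> for \<open>w powr m \<Gamma>(-m)\<close>, and
  \<open>- exp (-w)\<close>, as an exponential series, for the power series. As \<open>m\<close> is not an integer, solving
  for \<open>X(m)\<close> never divides by zero and carries the formula from negative \<open>m\<close> upwards in steps of \<open>1\<close>.
\<close>
theorem exp_neg_reciprocal_expansion:
  fixes m w :: real
  assumes "m \<notin> \<int>" "w > 0"
  shows "(\<lambda>k. (- w) ^ k / fact k / (real k - m)) sums
           (w powr m * Gamma (- m) - (LINT v:{0<..<1}|lborel. v powr (m - 1) * exp (- w / v)))"
proof -
  let ?I = "\<lambda>m. LINT v:{0<..<1}|lborel. v powr (m - 1) * exp (- w / v)"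
  let ?a = "\<lambda>k. (- w) ^ k / fact k :: real"
  have main: "(\<lambda>k. ?a k / (real k - m)) sums (w powr m * Gamma (- m) - ?I m)"
    if "m \<notin> \<int>" "m < real n" for n m
    using that
  proof (induction n arbitrary: m)
    case 0
    then show ?case
      using assms(2) by (intro exp_neg_reciprocal_expansion_negative) auto
  next
    case (Suc n)
    have m0: "m \<noteq> 0"
      using Suc.prems(1) by auto
    have mk: "real k - m \<noteq> 0" for k
      using Suc.prems(1) by (metis Ints_of_nat eq_iff_diff_eq_0)
    have "m - 1 \<notin> \<int>"
      using Suc.prems(1) by (metis Ints_1 Ints_add diff_add_cancel)
    then have IH: "(\<lambda>k. ?a k / (real k - (m - 1))) sums (w powr (m - 1) * Gamma (- (m - 1)) - ?I (m - 1))"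
      using Suc.prems by (intro Suc.IH) auto
    have shift: "- w * (?a k / (real k - (m - 1))) = ?a (Suc k) * real (Suc k) / (real (Suc k) - m)" for k
    proof -
      have "- w * ?a k = ?a (Suc k) * real (Suc k)"
        by (simp add: field_simps del: of_nat_Suc)
      moreover have "real k - (m - 1) = real (Suc k) - m"
        by simp
      ultimately show ?thesis
        by (simp only: times_divide_eq_right)
    qed
    have "(\<lambda>k. ?a (Suc k) * real (Suc k) / (real (Suc k) - m)) sums
        (- w * (w powr (m - 1) * Gamma (- (m - 1)) - ?I (m - 1)))"
      using sums_mult[OF IH, of "- w"] by (simp only: shift)
    then have "(\<lambda>k. ?a k * real k / (real k - m)) sums
        (- w * (w powr (m - 1) * Gamma (- (m - 1)) - ?I (m - 1)))"
      by (subst (asm) sums_Suc_iff) simp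
    moreover have "?a sums exp (- w)"
      using exp_converges[of "- w"] by (simp add: divide_inverse mult.commute)
    ultimately have "(\<lambda>k. ?a k * real k / (real k - m) - ?a k) sums
        (- w * (w powr (m - 1) * Gamma (- (m - 1)) - ?I (m - 1)) - exp (- w))"
      by (rule sums_diff)
    also have "(\<lambda>k. ?a k * real k / (real k - m) - ?a k) = (\<lambda>k. m * (?a k / (real k - m)))"
    proof
      fix k
      show "?a k * real k / (real k - m) - ?a k = m * (?a k / (real k - m))"
        using mk[of k] by (simp add: divide_simps) (simp add: algebra_simps)
    qed
    also have "- w * (w powr (m - 1) * Gamma (- (m - 1)) - ?I (m - 1)) - exp (- w)
        = m * (w powr m * Gamma (- m) - ?I m)"
    proof -
      have "- m \<notin> \<int>\<^sub>\<le>\<^sub>0"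
        using Suc.prems(1) nonpos_Ints_Int minus_in_Ints_iff by blast
      then have "Gamma (- (m - 1)) = - m * Gamma (- m)"
        using Gamma_plus1[of "- m"] by (simp add: add.commute)
      moreover have "w * w powr (m - 1) = w powr m"
        using assms by (simp add: powr_diff)
      moreover have "exp (- w) = m * ?I m + w * ?I (m - 1)"
        using exp_neg_reciprocal_recurrence[OF assms(2), of m] by simp
      ultimately show ?thesis
        by (simp add: algebra_simps)
    qed
    finally show ?case
      by (simp only: sums_mult_iff[OF m0])
  qed
  have "m < real (nat \<lceil>\<bar>m\<bar> + 1\<rceil>)"
    by linarith
  with assms(1) show ?thesis
    by (rule main)
qed

section \<open>Reduction to confluent hypergeometric series\<close>

text \<open>
  Fubini's theorem for series, obtained as termwise integration for the counting measure.
\<close>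
lemma
  fixes f :: "nat \<Rightarrow> nat \<Rightarrow> real"
  assumes bound: "\<And>n k. \<bar>f n k\<bar> \<le> A n * B k" and A: "summable A" and B: "summable B"
  shows summable_suminf_dominated: "summable (\<lambda>n. \<Sum>k. f n k)"
    and suminf_swap_dominated: "(\<lambda>k. \<Sum>n. f n k) sums (\<Sum>n. \<Sum>k. f n k)"
proof -
  let ?M = "count_space (UNIV :: nat set)"
  have int: "integrable ?M (\<lambda>n. f n k)" for k
    unfolding integrable_count_space_nat_iff
    by (rule summable_comparison_test'[OF summable_mult2[OF A, of "B k"]]) (use bound in auto)
  have sum_k: "summable (\<lambda>k. norm (f n k))" for n
    by (rule summable_comparison_test'[OF summable_mult[OF B, of "A n"]]) (use bound in auto)
  have sum_norm: "summable (\<lambda>k. \<integral>n. norm (f n k) \<partial>?M)"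
  proof (rule summable_comparison_test'[OF summable_mult[OF B, of "suminf A"]])
    fix k :: nat
    have "(\<integral>n. norm (f n k) \<partial>?M) = (\<Sum>n. norm (f n k))"
      using int[of k] by (intro integral_count_space_nat integrable_norm)
    also have "\<dots> \<le> (\<Sum>n. A n * B k)"
      using int[of k] bound
      by (intro suminf_le summable_mult2 A) (auto simp: integrable_count_space_nat_iff)
    also have "\<dots> = suminf A * B k"
      using suminf_mult2[OF A, of "B k"] by simp
    finally show "norm (\<integral>n. norm (f n k) \<partial>?M) \<le> suminf A * B k"
      by simp
  qed
  have int_sum: "integrable ?M (\<lambda>n. \<Sum>k. f n k)"
    by (rule integrable_suminf[OF int AE_I2[OF sum_k] sum_norm])
  then show "summable (\<lambda>n. \<Sum>k. f n k)"
    by (auto simp: integrable_count_space_nat_iff intro: summable_norm_cancel)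
  show "(\<lambda>k. \<Sum>n. f n k) sums (\<Sum>n. \<Sum>k. f n k)"
    using sums_integral[OF int AE_I2[OF sum_k] sum_norm]
    by (simp only: integral_count_space_nat[OF int] integral_count_space_nat[OF int_sum])
qed

text \<open>
  The denominators \<open>k - c - n\<close> of the double series are small where \<open>n\<close> is close to \<open>k - c\<close>, but not
  smaller than the distance of \<open>c\<close> to the integers. Trading a factor \<open>k + 1\<close> for \<open>1 / (n + 1)\<close>
  separates the two indices: \<open>1 / (n + 1)\<close> makes the sum over \<open>n\<close> converge, and \<open>k + 1\<close> is absorbed by \<open>1 / k!\<close>.
\<close>
lemma inverse_shift_bound:
  fixes c :: real
  assumes "c \<notin> \<int>"
  obtains K where "K > 0" "\<And>n k :: nat. 1 / \<bar>real k - (c + real n)\<bar> \<le> K * ((real k + 1) / (real n + 1))"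
proof
  \<comment> \<open>The distance of \<open>c\<close> to the nearest integer.\<close>
  define \<delta> where "\<delta> = min (frac c) (1 - frac c)"
  have \<delta>: "\<delta> > 0"
    using assms frac_lt_1[of c] by (simp add: \<delta>_def frac_gt_0_iff)
  have far: "\<delta> \<le> \<bar>c - of_int j\<bar>" for j
  proof (cases "j \<le> \<lfloor>c\<rfloor>")
    case True
    then have "real_of_int j \<le> of_int \<lfloor>c\<rfloor>" by simp
    then show ?thesis
      unfolding \<delta>_def frac_def by linarith
  next
    case False
    then have "real_of_int j \<ge> of_int \<lfloor>c\<rfloor> + 1" by linarith
    then show ?thesis
      unfolding \<delta>_def frac_def by linarith
  qed
  define K where "K = 1 + (1 + \<bar>c\<bar>) / \<delta>"
  show "K > 0"
    using \<delta> by (simp add: K_def add_pos_nonneg)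
  fix n k :: nat
  define d where "d = \<bar>real k - (c + real n)\<bar>"
  have d: "\<delta> \<le> d"
    using far[of "int k - int n"] by (simp add: d_def)
  have "real k + 1 + \<bar>c\<bar> \<le> (real k + 1) * (1 + \<bar>c\<bar>)"
    by (simp add: algebra_simps)
  also have "\<dots> \<le> d * ((real k + 1) * ((1 + \<bar>c\<bar>) / \<delta>))"
    using mult_right_mono[OF d, of "(real k + 1) * ((1 + \<bar>c\<bar>) / \<delta>)"] \<delta> by simp
  finally have "real k + 1 + \<bar>c\<bar> \<le> d * ((real k + 1) * ((1 + \<bar>c\<bar>) / \<delta>))" .
  moreover have "real n + 1 \<le> d + (real k + 1 + \<bar>c\<bar>)"
    unfolding d_def by linarith
  moreover have "d \<le> d * (real k + 1)"
    using d \<delta> by simp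
  moreover have "d * (K * (real k + 1)) = d * (real k + 1) + d * ((real k + 1) * ((1 + \<bar>c\<bar>) / \<delta>))"
    by (simp add: K_def algebra_simps)
  ultimately have "real n + 1 \<le> d * (K * (real k + 1))"
    by linarith
  then have "1 / d \<le> K * (real k + 1) / (real n + 1)"
    using d \<delta> by (simp add: divide_le_eq le_divide_eq mult.commute)
  then show "1 / \<bar>real k - (c + real n)\<bar> \<le> K * ((real k + 1) / (real n + 1))"
    by (simp add: d_def)
qed

lemma beta_partial_fractions_real:
  assumes "b > 0" "x \<notin> \<int>"
  shows "(\<lambda>n. beta_coeff b n / (x + real n)) sums (Gamma x * Gamma b * rGamma (x + b))"
proof -
  have "complex_of_real x \<notin> \<int>\<^sub>\<le>\<^sub>0"
    using assms(2) nonpos_Ints_Int by auto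
  note beta_partial_fractions[OF assms(1) this]
  moreover have "rGamma (complex_of_real x + of_real b) = of_real (rGamma (x + b))"
    by (simp only: of_real_add [symmetric] rGamma_complex_of_real)
  ultimately have "(\<lambda>n. complex_of_real (beta_coeff b n / (x + real n))) sums of_real (Gamma x * Gamma b * rGamma (x + b))"
    by (simp add: Gamma_complex_of_real)
  then show ?thesis
    by (simp only: sums_of_real_iff)
qed

lemma Gamma_shift_down:
  fixes x :: real
  assumes "x \<notin> \<int>"
  shows "Gamma (x - real k) = (-1) ^ k * Gamma x / pochhammer (1 - x) k"
proof -
  have "pochhammer (x - real k) k = (-1) ^ k * pochhammer (1 - x) k"
    using pochhammer_minus'[of "x - 1" k] by (simp add: algebra_simps)
  moreover have "x - real k \<notin> \<int>\<^sub>\<le>\<^sub>0"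
    using assms by (metis Ints_add Ints_of_nat diff_add_cancel nonpos_Ints_Int)
  then have "Gamma x = pochhammer (x - real k) k * Gamma (x - real k)"
    using pochhammer_Gamma[of "x - real k" k] by (simp add: Gamma_eq_zero_iff)
  moreover have "pochhammer (1 - x) k \<noteq> 0"
  proof
    assume "pochhammer (1 - x) k = 0"
    then obtain j where "1 - x = - real j"
      by (auto simp: pochhammer_eq_0_iff)
    then have "x = 1 + real j"
      by simp
    then show False
      using assms by simp
  qed
  ultimately show ?thesis
    by (simp add: field_simps)
qed

lemma rGamma_shift_down:
  fixes x :: real
  shows "rGamma (x - real k) = (-1) ^ k * pochhammer (1 - x) k * rGamma x"
proof -
  have "pochhammer (x - real k) k = (-1) ^ k * pochhammer (1 - x) k"
    using pochhammer_minus'[of "x - 1" k] by (simp add: algebra_simps)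
  then show ?thesis
    using pochhammer_rGamma[of "x - real k" k] by simp
qed

text \<open>
  The factor \<open>c = 0\<close> has to be covered: the second hypergeometric series is multiplied by a value of
  \<open>1 / \<Gamma>\<close>, which may vanish, and the premise then does not make \<open>f\<close> summable.
\<close>
lemma suminf_cmult_if_sums:
  fixes f :: "nat \<Rightarrow> real"
  assumes "(\<lambda>n. c * f n) sums s"
  shows "s = c * suminf f"
proof (cases "c = 0")
  case True
  then show ?thesis
    using assms by (simp add: sums_iff)
next
  case False
  then have "f sums (s / c)"
    using assms by (rule sums_mult_D[rotated])
  then show ?thesis
    using False by (simp add: sums_iff)
qed

text \<open>
  The double series \<open>t n k\<close> collects the power series parts of the incomplete Gamma integrals, with
  sum \<open>T\<close>. Summed over \<open>k\<close> first, it gives the first hypergeometric term minus the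
  integral; summed over \<open>n\<close> first, it gives minus the second hypergeometric term.
\<close>
theorem confluent_integral_hypergeometric:
  fixes b c w :: real
  assumes "b > 0" "w > 0" "c \<notin> \<int>"
  shows "confluent_integral b c w = Gamma (- c) * w powr c * hyp_1F1 (1 - b) (1 + c) (- w)
      + Gamma c * Gamma b * rGamma (c + b) * hyp_1F1 (1 - c - b) (1 - c) (- w)"
proof -
  let ?I = "\<lambda>m. LINT v:{0<..<1}|lborel. v powr (m - 1) * exp (- w / v)"
  let ?a = "\<lambda>k. (- w) ^ k / fact k :: real"
  define t where "t n k = beta_coeff b n * (?a k / (real k - (c + real n)))" for n k
  have notint: "c + real n \<notin> \<int>" "c - real n \<notin> \<int>" for n
    using assms(3) by (metis Ints_diff Ints_of_nat add_diff_cancel_right',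
        metis Ints_add Ints_of_nat diff_add_cancel)
  have outer: "(\<lambda>n. beta_coeff b n * ?I (c + real n)) sums confluent_integral b c w"
  proof -
    obtain C p where Cp: "p > 0" "\<And>v. 0 < v \<Longrightarrow> v powr (c - 1) * exp (- w / v) \<le> C * v powr (p - 1)"
      using exp_neg_reciprocal_dominated[OF assms(2)] by metis
    have "(\<lambda>n. beta_coeff b n *\<^sub>R (LINT v:{0<..<1}|lborel. v ^ n *\<^sub>R (v powr (c - 1) * exp (- w / v))))
       sums (LINT v:{0<..<1}|lborel. (1 - v) powr (b - 1) *\<^sub>R (v powr (c - 1) * exp (- w / v)))"
      using assms(1) Cp by (intro beta_weight_termwise_integration[where C = C and p = p]) auto
    moreover have "(LINT v:{0<..<1}|lborel. v ^ n *\<^sub>R (v powr (c - 1) * exp (- w / v))) = ?I (c + real n)" for n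
      by (intro set_lebesgue_integral_cong)
         (auto simp: powr_realpow [symmetric] powr_add [symmetric] mult.assoc [symmetric] algebra_simps)
    ultimately show ?thesis
      by (simp add: confluent_integral_def mult_ac)
  qed
  have inner: "(\<Sum>k. t n k) = beta_coeff b n * (w powr (c + real n) * Gamma (- (c + real n)) - ?I (c + real n))" for n
    using sums_mult[OF exp_neg_reciprocal_expansion[OF notint(1) assms(2)], of "beta_coeff b n"]
    by (simp add: t_def sums_iff)
  obtain K where K: "K > 0" "\<And>n k. 1 / \<bar>real k - (c + real n)\<bar> \<le> K * ((real k + 1) / (real n + 1))"
    using inverse_shift_bound[OF assms(3)] by metis
  have t_bound: "\<bar>t n k\<bar> \<le> (\<bar>beta_coeff b n\<bar> / (real n + 1)) * (K * (w ^ k / fact k * (real k + 1)))" for n k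
  proof -
    have "\<bar>t n k\<bar> = \<bar>beta_coeff b n\<bar> * (w ^ k / fact k) * (1 / \<bar>real k - (c + real n)\<bar>)"
      using assms(2) by (simp add: t_def abs_mult power_abs)
    also have "\<dots> \<le> \<bar>beta_coeff b n\<bar> * (w ^ k / fact k) * (K * ((real k + 1) / (real n + 1)))"
      using assms(2) by (intro mult_left_mono K) auto
    finally show ?thesis
      by (simp add: mult_ac)
  qed
  have summable_B: "summable (\<lambda>k. K * (w ^ k / fact k * (real k + 1)))"
  proof (intro summable_mult)
    have "summable (\<lambda>k. (2 * w) ^ k / fact k)"
      using summable_exp[of "2 * w"] by (simp add: divide_inverse mult.commute)
    then show "summable (\<lambda>k. w ^ k / fact k * (real k + 1))"
    proof (rule summable_comparison_test'[where N = 0])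
      fix k :: nat
      have "real k + 1 \<le> 2 ^ k"
        by (induction k) auto
      then have "w ^ k / fact k * (real k + 1) \<le> w ^ k / fact k * 2 ^ k"
        using assms(2) by (intro mult_left_mono) auto
      then show "norm (w ^ k / fact k * (real k + 1)) \<le> (2 * w) ^ k / fact k"
        using assms(2) by (simp add: power_mult_distrib mult_ac)
    qed
  qed
  note swap = summable_suminf_dominated[OF t_bound summable_beta_coeff[OF assms(1)] summable_B]
    suminf_swap_dominated[OF t_bound summable_beta_coeff[OF assms(1)] summable_B]
  define T where "T = (\<Sum>n. \<Sum>k. t n k)"
  have "(\<lambda>n. beta_coeff b n * (w powr (c + real n) * Gamma (- (c + real n)))) sums (T + confluent_integral b c w)"
    using sums_add[OF summable_sums[OF swap(1)] outer] by (simp add: T_def inner algebra_simps)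
  moreover have "beta_coeff b n * (w powr (c + real n) * Gamma (- (c + real n)))
      = Gamma (- c) * w powr c * (pochhammer (1 - b) n / (pochhammer (1 + c) n * fact n) * (- w) ^ n)" for n
  proof -
    have "- c \<notin> \<int>"
      using assms(3) by simp
    from Gamma_shift_down[OF this, of n]
    have "Gamma (- (c + real n)) = (-1) ^ n * Gamma (- c) / pochhammer (1 + c) n"
      by simp
    moreover have "w powr (c + real n) = w powr c * w ^ n"
      using assms(2) by (simp add: powr_add powr_realpow)
    ultimately show ?thesis
      by (simp add: beta_coeff_def power_minus[of w] mult_ac)
  qed
  ultimately have "T + confluent_integral b c w = Gamma (- c) * w powr c * hyp_1F1 (1 - b) (1 + c) (- w)"
    unfolding hyp_1F1_altdef by (intro suminf_cmult_if_sums) (simp only:)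
  moreover have "(\<lambda>k. \<Sum>n. t n k) = (\<lambda>k. - (Gamma c * Gamma b * rGamma (c + b)) *
      (pochhammer (1 - c - b) k / (pochhammer (1 - c) k * fact k) * (- w) ^ k))"
  proof
    fix k
    have "(\<lambda>n. - ?a k * (beta_coeff b n / (c - real k + real n))) sums
        (- ?a k * (Gamma (c - real k) * Gamma b * rGamma (c - real k + b)))"
      by (intro sums_mult beta_partial_fractions_real assms(1) notint)
    moreover have "- ?a k * (beta_coeff b n / (c - real k + real n)) = t n k" for n
    proof -
      have "real k - (c + real n) = - (c - real k + real n)"
        by simp
      then show ?thesis
        unfolding t_def by (simp only: divide_minus_right) simp
    qed
    ultimately have "(\<Sum>n. t n k) = - ?a k * (Gamma (c - real k) * Gamma b * rGamma (c - real k + b))"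
      by (simp add: sums_iff)
    also have "rGamma (c - real k + b) = (-1) ^ k * pochhammer (1 - c - b) k * rGamma (c + b)"
      using rGamma_shift_down[of "c + b" k] by (simp add: algebra_simps)
    also have "Gamma (c - real k) = (-1) ^ k * Gamma c / pochhammer (1 - c) k"
      by (rule Gamma_shift_down[OF assms(3)])
    finally show "(\<Sum>n. t n k) = - (Gamma c * Gamma b * rGamma (c + b)) *
      (pochhammer (1 - c - b) k / (pochhammer (1 - c) k * fact k) * (- w) ^ k)"
      by (simp add: mult_ac flip: power_mult_distrib)
  qed
  with swap(2) have "T = - (Gamma c * Gamma b * rGamma (c + b)) * hyp_1F1 (1 - c - b) (1 - c) (- w)"
    unfolding hyp_1F1_altdef T_def by (intro suminf_cmult_if_sums) (simp only:)
  ultimately show ?thesis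
    by simp
qed


section \<open>The integral and hypergeometric representations together\<close>

theorem theorem2p4:
  fixes \<alpha> \<beta> \<gamma> a u :: real
  assumes "\<alpha> > -1" and "\<gamma> > -1" and "a > 0" and "\<beta> > 0" and "u > 0"
  shows "let G = meijer_G 2 0 [of_real (\<alpha> + \<beta>)] [of_real \<alpha>, of_real \<gamma>] (a * u);
             f = (\<lambda>v. v powr (\<gamma> - \<alpha> - \<beta>) * (v - u) powr (\<beta> - 1) * exp (- a * v));
             g = (\<lambda>v. v powr (\<alpha> - \<gamma> - 1) * (1 - v) powr (\<beta> - 1) * exp (- a * u / v))
         in has_meijer_G 2 0 [of_real (\<alpha> + \<beta>)] [of_real \<alpha>, of_real \<gamma>] (a * u) G \<and>
            f integrable_on {u<..} \<and> g integrable_on {0<..<1} \<and>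
            G = of_real (a powr \<gamma> / Gamma \<beta> * u powr \<alpha> * integral {u<..} f) \<and>
            G = of_real (a powr \<gamma> / Gamma \<beta> * u powr \<gamma> * integral {0<..<1} g) \<and>
            ((\<forall>\<nu>::nat. \<alpha> - \<gamma> \<noteq> real \<nu> \<and> \<alpha> - \<gamma> \<noteq> - real \<nu>) \<longrightarrow>
               G = of_real (
                 Gamma (\<gamma> - \<alpha>) / Gamma \<beta> * (a * u) powr \<alpha>
                   * hyp_1F1 (1 - \<beta>) (1 + \<alpha> - \<gamma>) (- a * u) +
                 Gamma (\<alpha> - \<gamma>) * rGamma (\<alpha> + \<beta> - \<gamma>) * (a * u) powr \<gamma>
                   * hyp_1F1 (1 + \<gamma> - \<alpha> - \<beta>) (1 + \<gamma> - \<alpha>) (- a * u)))"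
proof -
  define F where "F = confluent_integral \<beta> (\<alpha> - \<gamma>) (a * u)"
  define G where "G = complex_of_real ((a * u) powr \<gamma> / Gamma \<beta> * F)"
  let ?f = "\<lambda>v. v powr (\<gamma> - \<alpha> - \<beta>) * (v - u) powr (\<beta> - 1) * exp (- a * v)"
  let ?g = "\<lambda>v. v powr (\<alpha> - \<gamma> - 1) * (1 - v) powr (\<beta> - 1) * exp (- a * u / v)"
  have au: "a * u > 0"
    using assms by simp
  have G: "has_meijer_G 2 0 [of_real (\<alpha> + \<beta>)] [of_real \<alpha>, of_real \<gamma>] (a * u) G"
    unfolding G_def F_def by (rule has_meijer_G_confluent_integral[OF assms(4) au])
  have G_eq: "meijer_G 2 0 [of_real (\<alpha> + \<beta>)] [of_real \<alpha>, of_real \<gamma>] (a * u) = G"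
    by (rule meijer_G_eqI[OF G])
  have f_int: "?f integrable_on {u<..}" and f_val: "integral {u<..} ?f = u powr (\<gamma> - \<alpha>) * F"
    using confluent_integral_half_line[of \<beta> a u \<gamma> \<alpha>] assms set_lebesgue_integral_eq_integral(1)
    unfolding F_def by blast+
  have g: "set_integrable lborel {0<..<1} ?g"
    using set_integrable_confluent_kernel[OF assms(4) au, of "\<alpha> - \<gamma>"] by simp
  have g_int: "?g integrable_on {0<..<1}" and g_val: "integral {0<..<1} ?g = F"
    using set_borel_integral_eq_integral[OF g] by (simp_all add: F_def confluent_integral_def)
  have "u powr \<alpha> * u powr (\<gamma> - \<alpha>) = u powr \<gamma>"
    by (simp flip: powr_add)
  then have G_f: "G = of_real (a powr \<gamma> / Gamma \<beta> * u powr \<alpha> * integral {u<..} ?f)"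
    unfolding f_val G_def using assms by (simp add: powr_mult mult_ac flip: of_real_mult)
  have G_g: "G = of_real (a powr \<gamma> / Gamma \<beta> * u powr \<gamma> * integral {0<..<1} ?g)"
    unfolding g_val G_def using assms by (simp add: powr_mult)
  have G_hyp: "G = of_real (Gamma (\<gamma> - \<alpha>) / Gamma \<beta> * (a * u) powr \<alpha>
                   * hyp_1F1 (1 - \<beta>) (1 + \<alpha> - \<gamma>) (- a * u) +
                 Gamma (\<alpha> - \<gamma>) * rGamma (\<alpha> + \<beta> - \<gamma>) * (a * u) powr \<gamma>
                   * hyp_1F1 (1 + \<gamma> - \<alpha> - \<beta>) (1 + \<gamma> - \<alpha>) (- a * u))"
    if nonint: "\<forall>\<nu>::nat. \<alpha> - \<gamma> \<noteq> real \<nu> \<and> \<alpha> - \<gamma> \<noteq> - real \<nu>"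
  proof -
    have c: "\<alpha> - \<gamma> \<notin> \<int>"
    proof
      assume "\<alpha> - \<gamma> \<in> \<int>"
      then obtain j where "\<alpha> - \<gamma> = of_int j"
        by (elim Ints_cases)
      then show False
        using nonint by (cases j rule: int_cases2) auto
    qed
    have "(a * u) powr \<gamma> * (a * u) powr (\<alpha> - \<gamma>) = (a * u) powr \<alpha>"
      by (simp flip: powr_add)
    moreover have "Gamma \<beta> \<noteq> 0"
      using Gamma_real_pos[OF assms(4)] by (metis less_irrefl)
    ultimately show ?thesis
      unfolding G_def F_def confluent_integral_hypergeometric[OF assms(4) au c]
      by (intro arg_cong[of _ _ complex_of_real]) (simp add: field_simps)
  qed
  show ?thesis
    unfolding Let_def G_eq using G f_int g_int G_f G_g G_hyp by blast
qed

end
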